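(* Let $u:M\times[a,b]\to\mathbb{R}$ be a smooth function with $u(\cdot,a)\not\equiv 0$ which solves $$u_t(x,t)-\mathcal{L}u(x,t)=\phi(t)\,u(x,t)\quad\text{on } M\times[a,b],$$ where $\phi$ is a smooth function of $t\in[a,b]$. Then $$I(b)\ \ge\ I(a)\,e^{2\int_a^b\phi(t)\,dt+2U(a)(b-a)}.$$
   Context: $(M,g)$ is a closed (compact, without boundary) Riemannian manifold with Riemannian volume form $d\nu$, $f\in C^\infty(M)$ is a real-valued function, and $d\mu=e^{-f}d\nu$ is the weighted measure. $T$ is a smooth symmetric positive definite $(1,1)$-tensor on $M$ (independent of time); for vector fields $X,Y$ write $T(X,Y)=\langle T(X),Y\rangle$. The operator $\mathcal{L}$ acts on $C^2$ functions by $$\mathcal{L}u=\mathrm{div}_f(T(\nabla u))=e^{f}\,\mathrm{div}(e^{-f}T(\nabla u))=\mathrm{div}(T(\nabla u))-\langle\nabla f,T(\nabla u)\rangle .$$ For a function $u$ on $M\times[a,b]$, $\nabla$ and $\mathcal{L}$ act in the $M$-variable, and $$D(t)=-\int_M T(\nabla u,\nabla u)\,d\mu=\int_M u\,\mathcal{L}u\,d\mu,\qquad I(t)=\int_M u^2\,d\mu,\qquad U(t)=\frac{D(t)}{I(t)}.$$ *)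

theory Defs
  imports "HOL-Analysis.Analysis"
begin

section \<open>Smooth functions on subsets of normed spaces\<close>

fun Ck_on :: "nat \<Rightarrow> 'a::real_normed_vector set \<Rightarrow> ('a \<Rightarrow> 'b::real_normed_vector) \<Rightarrow> bool" where
  "Ck_on 0 S F \<longleftrightarrow> continuous_on S F"
| "Ck_on (Suc k) S F \<longleftrightarrow> (\<forall>x\<in>S. F differentiable (at x)) \<and>
     (\<forall>v. Ck_on k S (\<lambda>x. frechet_derivative F (at x) v))"

text \<open>
  \<^term>\<open>Ck_on\<close> is meant for open sets in finite-dimensional spaces. On an arbitrary set, a function
  is smooth if near each point of the set it is the restriction of a smooth function on an open set;
  for open sets this is the usual notion, and for a compact interval (or its product with an open
  set) it is smoothness up to the end points.
\<close>

definition smooth_on :: "'a::euclidean_space set \<Rightarrow> ('a \<Rightarrow> 'b::euclidean_space) \<Rightarrow> bool" where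
  "smooth_on S F \<longleftrightarrow>
     (\<forall>x\<in>S. \<exists>W G. open W \<and> x \<in> W \<and> (\<forall>k. Ck_on k W G) \<and> (\<forall>y\<in>S \<inter> W. G y = F y))"


section \<open>Smooth manifolds\<close>

text \<open>
  The manifold is the whole type \<^typ>\<open>'m\<close>. A chart is a pair of a domain and a coordinate map, whose
  values outside the domain are irrelevant.
\<close>

type_synonym ('m, 'n) chart = "'m set \<times> ('m \<Rightarrow> real ^ 'n)"

abbreviation chart_dom :: "('m, 'n) chart \<Rightarrow> 'm set" where
  "chart_dom c \<equiv> fst c"

abbreviation chart_map :: "('m, 'n) chart \<Rightarrow> 'm \<Rightarrow> real ^ 'n" where
  "chart_map c \<equiv> snd c"

definition chart_img :: "('m, 'n) chart \<Rightarrow> (real ^ 'n) set" where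
  "chart_img c = chart_map c ` chart_dom c"

definition chart_inv :: "('m, 'n) chart \<Rightarrow> real ^ 'n \<Rightarrow> 'm" where
  "chart_inv c = inv_into (chart_dom c) (chart_map c)"

definition smooth_atlas :: "('m::topological_space, 'n::finite) chart set \<Rightarrow> bool" where
  "smooth_atlas A \<longleftrightarrow>
     (\<forall>c\<in>A. open (chart_dom c) \<and> open (chart_img c) \<and>
        homeomorphism (chart_dom c) (chart_img c) (chart_map c) (chart_inv c)) \<and>
     (\<Union>c\<in>A. chart_dom c) = UNIV \<and>
     (\<forall>c\<in>A. \<forall>d\<in>A. smooth_on (chart_map c ` (chart_dom c \<inter> chart_dom d))
        (\<lambda>x. chart_map d (chart_inv c x)))"

text \<open>
  Objects given by components in each chart are evaluated at a point \<open>p\<close> in this chart; the values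
  defined this way below do not depend on the choice.
\<close>

definition chart_at :: "('m, 'n) chart set \<Rightarrow> 'm \<Rightarrow> ('m, 'n) chart" where
  "chart_at A p = (SOME c. c \<in> A \<and> p \<in> chart_dom c)"

definition transition_jacobian ::
    "('m, 'n::finite) chart \<Rightarrow> ('m, 'n) chart \<Rightarrow> 'm \<Rightarrow> real ^ 'n ^ 'n" where
  "transition_jacobian c d p =
     jacobian (\<lambda>x. chart_map d (chart_inv c x)) (at (chart_map c p))"

definition smooth_fun :: "('m, 'n::finite) chart set \<Rightarrow> ('m \<Rightarrow> real) \<Rightarrow> bool" where
  "smooth_fun A h \<longleftrightarrow> (\<forall>c\<in>A. smooth_on (chart_img c) (\<lambda>x. h (chart_inv c x)))"

text \<open>Smoothness on the product of the manifold with a time interval \<open>J\<close>.\<close>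

definition smooth_fun_time ::
    "('m, 'n::finite) chart set \<Rightarrow> real set \<Rightarrow> ('m \<Rightarrow> real \<Rightarrow> real) \<Rightarrow> bool" where
  "smooth_fun_time A J u \<longleftrightarrow>
     (\<forall>c\<in>A. smooth_on (chart_img c \<times> J) (\<lambda>(x, t). u (chart_inv c x) t))"


section \<open>Tensor fields, as component functions obeying the transformation laws\<close>

type_synonym ('m, 'n) vector_components = "('m, 'n) chart \<Rightarrow> 'm \<Rightarrow> real ^ 'n"
type_synonym ('m, 'n) tensor_components = "('m, 'n) chart \<Rightarrow> 'm \<Rightarrow> real ^ 'n ^ 'n"

definition riemannian_metric ::
    "('m, 'n::finite) chart set \<Rightarrow> ('m, 'n) tensor_components \<Rightarrow> bool" where
  "riemannian_metric A g \<longleftrightarrow>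
     (\<forall>c\<in>A. smooth_on (chart_img c) (\<lambda>x. g c (chart_inv c x)) \<and>
        (\<forall>p\<in>chart_dom c. transpose (g c p) = g c p \<and> (\<forall>v. v \<noteq> 0 \<longrightarrow> v \<bullet> (g c p *v v) > 0))) \<and>
     (\<forall>c\<in>A. \<forall>d\<in>A. \<forall>p\<in>chart_dom c \<inter> chart_dom d.
        g c p = transpose (transition_jacobian c d p) ** g d p ** transition_jacobian c d p)"

text \<open>The components \<open>T c p\<close> of a (1,1)-tensor form the matrix of an endomorphism of the tangent space.\<close>

definition smooth_tensor11 ::
    "('m, 'n::finite) chart set \<Rightarrow> ('m, 'n) tensor_components \<Rightarrow> bool" where
  "smooth_tensor11 A T \<longleftrightarrow>
     (\<forall>c\<in>A. smooth_on (chart_img c) (\<lambda>x. T c (chart_inv c x))) \<and>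
     (\<forall>c\<in>A. \<forall>d\<in>A. \<forall>p\<in>chart_dom c \<inter> chart_dom d.
        T d p ** transition_jacobian c d p = transition_jacobian c d p ** T c p)"

definition symmetric_tensor11 ::
    "('m, 'n::finite) chart set \<Rightarrow> ('m, 'n) tensor_components \<Rightarrow> ('m, 'n) tensor_components \<Rightarrow> bool"
  where
  "symmetric_tensor11 A g T \<longleftrightarrow>
     (\<forall>c\<in>A. \<forall>p\<in>chart_dom c. \<forall>v w. (T c p *v v) \<bullet> (g c p *v w) = v \<bullet> (g c p *v (T c p *v w)))"

definition pos_def_tensor11 ::
    "('m, 'n::finite) chart set \<Rightarrow> ('m, 'n) tensor_components \<Rightarrow> ('m, 'n) tensor_components \<Rightarrow> bool"
  where
  "pos_def_tensor11 A g T \<longleftrightarrow>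
     (\<forall>c\<in>A. \<forall>p\<in>chart_dom c. \<forall>v. v \<noteq> 0 \<longrightarrow> (T c p *v v) \<bullet> (g c p *v v) > 0)"

definition apply_tensor ::
    "('m, 'n::finite) tensor_components \<Rightarrow> ('m, 'n) vector_components \<Rightarrow> ('m, 'n) vector_components"
  where
  "apply_tensor T X c p = T c p *v X c p"

definition metric_inner ::
    "('m, 'n::finite) chart set \<Rightarrow> ('m, 'n) tensor_components \<Rightarrow>
     ('m, 'n) vector_components \<Rightarrow> ('m, 'n) vector_components \<Rightarrow> 'm \<Rightarrow> real" where
  "metric_inner A g X Y p = (let c = chart_at A p in X c p \<bullet> (g c p *v Y c p))"


section \<open>Gradient, divergence and volume\<close>

definition partial_deriv :: "(real ^ 'n \<Rightarrow> real) \<Rightarrow> 'n::finite \<Rightarrow> real ^ 'n \<Rightarrow> real" where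
  "partial_deriv F i x = frechet_derivative F (at x) (axis i 1)"

definition gradient ::
    "('m, 'n::finite) tensor_components \<Rightarrow> ('m \<Rightarrow> real) \<Rightarrow> ('m, 'n) vector_components" where
  "gradient g h c p =
     matrix_inv (g c p) *v (\<chi> j. partial_deriv (\<lambda>x. h (chart_inv c x)) j (chart_map c p))"

definition volume_density :: "('m, 'n::finite) tensor_components \<Rightarrow> ('m, 'n) chart \<Rightarrow> 'm \<Rightarrow> real" where
  "volume_density g c p = sqrt (det (g c p))"

text \<open>The divergence with respect to the Riemannian volume form,
  \<open>div X = (1 / sqrt |g|) \<Sum>\<^sub>i \<partial>\<^sub>i (sqrt |g| X\<^sup>i)\<close>.\<close>

definition divergence ::
    "('m, 'n::finite) chart set \<Rightarrow> ('m, 'n) tensor_components \<Rightarrow> ('m, 'n) vector_components \<Rightarrow>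
     'm \<Rightarrow> real" where
  "divergence A g X p = (let c = chart_at A p in
     (\<Sum>i\<in>UNIV. partial_deriv
        (\<lambda>x. volume_density g c (chart_inv c x) * X c (chart_inv c x) $ i) i (chart_map c p))
     / volume_density g c p)"

text \<open>The Riemannian volume is the Borel measure that has density \<open>sqrt |g|\<close> in every chart.\<close>

definition riemannian_volume ::
    "('m::topological_space, 'n::finite) chart set \<Rightarrow> ('m, 'n) tensor_components \<Rightarrow>
     'm measure \<Rightarrow> bool" where
  "riemannian_volume A g \<nu> \<longleftrightarrow> sets \<nu> = sets borel \<and>
     (\<forall>c\<in>A. \<forall>B\<in>sets borel. B \<subseteq> chart_dom c \<longrightarrow>
        emeasure \<nu> B =
          (\<integral>\<^sup>+x\<in>chart_map c ` B. ennreal (volume_density g c (chart_inv c x)) \<partial>lborel))"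

definition weighted_measure :: "'m measure \<Rightarrow> ('m \<Rightarrow> real) \<Rightarrow> 'm measure" where
  "weighted_measure \<nu> f = density \<nu> (\<lambda>p. ennreal (exp (- f p)))"


section \<open>The operator and the frequency functional\<close>

definition weighted_divergence ::
    "('m, 'n::finite) chart set \<Rightarrow> ('m, 'n) tensor_components \<Rightarrow> ('m \<Rightarrow> real) \<Rightarrow>
     ('m, 'n) vector_components \<Rightarrow> 'm \<Rightarrow> real" where
  "weighted_divergence A g f X p =
     exp (f p) * divergence A g (\<lambda>c q. exp (- f q) *\<^sub>R X c q) p"

definition L_op ::
    "('m, 'n::finite) chart set \<Rightarrow> ('m, 'n) tensor_components \<Rightarrow> ('m, 'n) tensor_components \<Rightarrow>
     ('m \<Rightarrow> real) \<Rightarrow> ('m \<Rightarrow> real) \<Rightarrow> 'm \<Rightarrow> real" where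
  "L_op A g T f h = weighted_divergence A g f (apply_tensor T (gradient g h))"

definition D_fun ::
    "('m, 'n::finite) chart set \<Rightarrow> ('m, 'n) tensor_components \<Rightarrow> ('m, 'n) tensor_components \<Rightarrow>
     'm measure \<Rightarrow> ('m \<Rightarrow> real \<Rightarrow> real) \<Rightarrow> real \<Rightarrow> real" where
  "D_fun A g T \<mu> u t =
     - (\<integral>p. metric_inner A g (apply_tensor T (gradient g (\<lambda>q. u q t))) (gradient g (\<lambda>q. u q t)) p \<partial>\<mu>)"

definition I_fun :: "'m measure \<Rightarrow> ('m \<Rightarrow> real \<Rightarrow> real) \<Rightarrow> real \<Rightarrow> real" where
  "I_fun \<mu> u t = (\<integral>p. (u p t)\<^sup>2 \<partial>\<mu>)"

definition U_fun ::
    "('m, 'n::finite) chart set \<Rightarrow> ('m, 'n) tensor_components \<Rightarrow> ('m, 'n) tensor_components \<Rightarrow>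
     'm measure \<Rightarrow> ('m \<Rightarrow> real \<Rightarrow> real) \<Rightarrow> real \<Rightarrow> real" where
  "U_fun A g T \<mu> u t = D_fun A g T \<mu> u t / I_fun \<mu> u t"

end

theory Submission
  imports Defs
begin

text \<open>
  The factor \<open>exp (- \<integral> \<phi>)\<close> removes the right-hand side: \<open>v t = exp (- \<integral>\<^sub>a\<^sup>t \<phi>) u t\<close> solves
  \<open>v\<^sub>t = L v\<close>, and it agrees with \<open>u\<close> at time \<open>a\<close>. Since \<open>I' = 2 \<integral> v L v = 2 D\<close>, the claim for
  \<open>v\<close> says that \<open>log I\<close> lies at \<open>b\<close> above its tangent at \<open>a\<close>. So it is enough that \<open>log I\<close> is
  convex in the midpoint sense, and this follows from the self-adjointness of \<open>L\<close> without
  differentiating \<open>D\<close>: for fixed \<open>m\<close> the integral of \<open>v (m + s) v (m - s)\<close> has the derivative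
  \<open>\<integral> L v (m + s) v (m - s) - v (m + s) L v (m - s) = 0\<close> in \<open>s\<close>, hence \<open>I m\<close> is the integral of
  \<open>v (m + h) v (m - h)\<close>, and the Cauchy-Schwarz inequality gives \<open>(I m)\<^sup>2 \<le> I (m - h) I (m + h)\<close>.
  Applied at \<open>a + h\<close>, \<open>a + 2 h\<close>, \<open>a + 4 h\<close>, and so on, with \<open>h = (b - a) / 2\<^sup>n\<close>, this becomes
  \<open>(I (a + h) / I a)\<close> to the power \<open>2\<^sup>n\<close> is at most \<open>I b / I a\<close>; the left-hand side tends to
  \<open>exp (2 U a (b - a))\<close> (lemmas \<open>midpoint_log_convex_tangent\<close> and \<open>heat_flow_energy_bound\<close>).

  Self-adjointness comes from Green's formula \<open>\<integral> w L z = - \<integral> T (\<nabla> z, \<nabla> w)\<close>, whose right-hand side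
  is symmetric. If \<open>w\<close> has compact support in a chart, the difference of the two sides is, in
  coordinates, a sum of integrals over \<open>real ^ 'n\<close> of partial derivatives of compactly supported
  \<open>C\<^sup>1\<close> functions, and these vanish by translation invariance (lemma \<open>green_in_chart\<close>). A finite
  family of cut-off functions reduces the general case to this one.

  One point is hidden in the definition of \<open>L\<close>: at each point it uses the coordinate formula for
  the divergence in some chosen chart, so the choice must be shown not to matter. Instead of
  transforming the formula, which involves derivatives of Jacobian determinants, one compares its
  integrals against cut-off functions: by Green's formula in both charts they equal the same integral,
  because the volume and the density \<open>T (\<nabla> z, \<nabla> w)\<close> do not depend on the chart, and two continuous
  functions with the same integrals against all cut-offs agree (lemma \<open>chart_op_le\<close>).
\<close>

section \<open>Functions of class \<open>C\<^sup>k\<close>\<close>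

lemma Ck_on_subset: "Ck_on k S F \<Longrightarrow> S' \<subseteq> S \<Longrightarrow> Ck_on k S' F"
  by (induction k arbitrary: F) (auto intro: continuous_on_subset)

lemma Ck_on_Suc_imp: "Ck_on (Suc k) S F \<Longrightarrow> Ck_on k S F"
proof (induction k arbitrary: F)
  case 0
  then show ?case
    by (auto intro!: continuous_at_imp_continuous_on differentiable_imp_continuous_within)
next
  case (Suc k)
  show ?case using Suc.prems Suc.IH by (simp only: Ck_on.simps) blast
qed

lemma Ck_on_cong:
  assumes "open S" "\<And>x. x \<in> S \<Longrightarrow> F x = G x" "Ck_on k S F"
  shows "Ck_on k S G"
  using assms(2,3)
proof (induction k arbitrary: F G)
  case 0
  then show ?case by (auto cong: continuous_on_cong)
next
  case (Suc k)
  have D: "(G has_derivative frechet_derivative F (at x)) (at x)" if "x \<in> S" for x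
  proof -
    have "(F has_derivative frechet_derivative F (at x)) (at x)"
      using Suc.prems(2) that by (simp add: frechet_derivative_works)
    then show ?thesis
      by (rule has_derivative_transform_within_open[OF _ assms(1) that]) (use Suc.prems in auto)
  qed
  have "Ck_on k S (\<lambda>x. frechet_derivative G (at x) v)" for v
  proof (rule Suc.IH)
    show "Ck_on k S (\<lambda>x. frechet_derivative F (at x) v)" using Suc.prems by simp
    show "frechet_derivative F (at x) v = frechet_derivative G (at x) v" if "x \<in> S" for x
      using frechet_derivative_at[OF D[OF that]] by simp
  qed
  with D show ?case by (auto simp: differentiable_def)
qed

lemma continuous_on_local:
  assumes "\<And>x. x \<in> S \<Longrightarrow> \<exists>W. open W \<and> x \<in> W \<and> continuous_on (S \<inter> W) F"
  shows "continuous_on S F"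
  unfolding continuous_on_def
proof
  fix x assume x: "x \<in> S"
  then obtain W where W: "open W" "x \<in> W" "continuous_on (S \<inter> W) F" using assms by blast
  have "(F \<longlongrightarrow> F x) (at x within (S \<inter> W))" using W x by (auto simp: continuous_on_def)
  also have "at x within (S \<inter> W) = at x within S"
    by (rule at_within_nhd[of x W]) (use W in auto)
  finally show "(F \<longlongrightarrow> F x) (at x within S)" .
qed

lemma Ck_on_local:
  assumes "\<And>x. x \<in> S \<Longrightarrow> \<exists>W. open W \<and> x \<in> W \<and> Ck_on k W F"
  shows "Ck_on k S F"
  using assms
proof (induction k arbitrary: F)
  case 0
  show ?case unfolding Ck_on.simps
    by (rule continuous_on_local) (metis "0.prems" Ck_on.simps(1) continuous_on_subset inf_le2)
next
  case (Suc k)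
  show ?case unfolding Ck_on.simps
  proof (intro conjI allI ballI)
    show "F differentiable at x" if "x \<in> S" for x using Suc.prems[OF that] by auto
    show "Ck_on k S (\<lambda>x. frechet_derivative F (at x) v)" for v
      by (rule Suc.IH) (use Suc.prems in fastforce)
  qed
qed

lemma smooth_on_imp_Ck_on:
  assumes "open S" "smooth_on S F"
  shows "Ck_on k S F"
proof (rule Ck_on_local)
  fix x assume x: "x \<in> S"
  then obtain W G where W: "open W" "x \<in> W" "\<forall>k. Ck_on k W G" "\<forall>y\<in>S \<inter> W. G y = F y"
    using assms(2) unfolding smooth_on_def by blast
  have "Ck_on k (S \<inter> W) F"
    by (rule Ck_on_cong[of _ G]) (use W assms in \<open>auto intro: Ck_on_subset\<close>)
  then show "\<exists>W. open W \<and> x \<in> W \<and> Ck_on k W F" using W x assms(1) by (meson IntI open_Int)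
qed

lemma smooth_on_imp_continuous_on:
  assumes "smooth_on S F" shows "continuous_on S F"
proof (rule continuous_on_local)
  fix x assume x: "x \<in> S"
  then obtain W G where W: "open W" "x \<in> W" "\<forall>k. Ck_on k W G" "\<forall>y\<in>S \<inter> W. G y = F y"
    using assms unfolding smooth_on_def by blast
  then have "continuous_on W G" by (metis Ck_on.simps(1))
  then have "continuous_on (S \<inter> W) F" using W(4)
    by (metis continuous_on_cong continuous_on_subset inf_le2)
  then show "\<exists>W. open W \<and> x \<in> W \<and> continuous_on (S \<inter> W) F" using W by blast
qed

lemma Ck_on_bounded_linear:
  assumes "open S" "bounded_linear h" "Ck_on k S F"
  shows "Ck_on k S (\<lambda>x. h (F x))"
  using assms(3)
proof (induction k arbitrary: F)
  case 0
  then show ?case using assms(2) by (auto intro: bounded_linear.continuous_on)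
next
  case (Suc k)
  have D: "((\<lambda>x. h (F x)) has_derivative (\<lambda>v. h (frechet_derivative F (at x) v))) (at x)" if "x \<in> S" for x
    using Suc.prems that by (intro bounded_linear.has_derivative[OF assms(2)]) (simp add: frechet_derivative_works)
  have eq: "frechet_derivative (\<lambda>x. h (F x)) (at x) v = h (frechet_derivative F (at x) v)" if "x \<in> S" for x v
    using frechet_derivative_at[OF D[OF that]] by metis
  show ?case unfolding Ck_on.simps
  proof (intro conjI allI ballI)
    show "(\<lambda>x. h (F x)) differentiable at x" if "x \<in> S" for x
      using D[OF that] by (auto simp: differentiable_def)
    fix v
    have "Ck_on k S (\<lambda>x. h (frechet_derivative F (at x) v))" using Suc.prems by (intro Suc.IH) simp
    then show "Ck_on k S (\<lambda>x. frechet_derivative (\<lambda>x. h (F x)) (at x) v)"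
      by (elim Ck_on_cong[OF assms(1), rotated]) (simp add: eq)
  qed
qed

text \<open>
  Fixing the second variable restricts the derivative to vectors of the form \<open>(v, 0)\<close>. This is how
  regularity in space and time yields regularity in space at each time.
\<close>

lemma Ck_on_slice:
  fixes G :: "'a::real_normed_vector \<times> 'b::real_normed_vector \<Rightarrow> 'c::real_normed_vector"
  assumes "open W" "Ck_on k W G"
  shows "Ck_on k {x. (x, t) \<in> W} (\<lambda>x. G (x, t))"
  using assms(2)
proof (induction k arbitrary: G)
  case 0
  have "continuous_on {x. (x, t) \<in> W} (\<lambda>x. G (x, t))"
    by (rule continuous_on_compose2[of W G]) (use 0 in \<open>auto intro!: continuous_intros\<close>)
  then show ?case by simp
next
  case (Suc k)
  have D: "((\<lambda>x. G (x, t)) has_derivative (\<lambda>v. frechet_derivative G (at (x, t)) (v, 0))) (at x)"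
    if "(x, t) \<in> W" for x
  proof -
    have "(G has_derivative frechet_derivative G (at (x, t))) (at (x, t))"
      using Suc.prems that by (simp add: frechet_derivative_works)
    then show ?thesis
      by (rule has_derivative_compose[rotated, of G _ "\<lambda>x. (x, t)"])
        (auto intro!: derivative_eq_intros)
  qed
  have eq: "frechet_derivative (\<lambda>x. G (x, t)) (at x) v = frechet_derivative G (at (x, t)) (v, 0)"
    if "(x, t) \<in> W" for x v
    using frechet_derivative_at[OF D[OF that]] by metis
  show ?case unfolding Ck_on.simps
  proof (intro conjI allI ballI)
    show "(\<lambda>x. G (x, t)) differentiable at x" if "x \<in> {x. (x, t) \<in> W}" for x
      using D that by (auto simp: differentiable_def)
    fix v
    have "Ck_on k {x. (x, t) \<in> W} (\<lambda>x. frechet_derivative G (at (x, t)) (v, 0))"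
      using Suc.prems by (intro Suc.IH) simp
    moreover have "open {x. (x, t) \<in> W}"
      using open_vimage[OF assms(1), of "\<lambda>x. (x, t)"]
      by (simp add: vimage_def continuous_intros)
    ultimately show "Ck_on k {x. (x, t) \<in> W} (\<lambda>x. frechet_derivative (\<lambda>x. G (x, t)) (at x) v)"
      by (elim Ck_on_cong[rotated 2]) (auto simp: eq)
  qed
qed

declare Ck_on.simps [simp del]

text \<open>
  The case \<open>k = 1\<close> of \<^const>\<open>Ck_on\<close>, with the derivative as an explicit witness: this is what the
  usual rules of differentiation produce.
\<close>

definition C1_on :: "'a::real_normed_vector set \<Rightarrow> ('a \<Rightarrow> 'b::real_normed_vector) \<Rightarrow> bool" where
  "C1_on S F \<longleftrightarrow> (\<exists>F'. (\<forall>x\<in>S. (F has_derivative F' x) (at x)) \<and> (\<forall>v. continuous_on S (\<lambda>x. F' x v)))"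

lemma C1_on_iff_Ck_on: "C1_on S F \<longleftrightarrow> Ck_on (Suc 0) S F"
proof
  assume "Ck_on (Suc 0) S F"
  then show "C1_on S F" unfolding C1_on_def
    by (intro exI[of _ "\<lambda>x. frechet_derivative F (at x)"]) (auto simp: frechet_derivative_works Ck_on.simps)
next
  assume "C1_on S F"
  then obtain F' where F': "\<And>x. x \<in> S \<Longrightarrow> (F has_derivative F' x) (at x)"
    "\<And>v. continuous_on S (\<lambda>x. F' x v)" unfolding C1_on_def by blast
  have "frechet_derivative F (at x) = F' x" if "x \<in> S" for x
    using frechet_derivative_at[OF F'(1)[OF that]] by simp
  then have "continuous_on S (\<lambda>x. frechet_derivative F (at x) v)" for v
    using F'(2)[of v] by (simp cong: continuous_on_cong)
  then show "Ck_on (Suc 0) S F" using F'(1) by (auto simp: differentiable_def Ck_on.simps)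
qed

lemma C1_on_cong: "open S \<Longrightarrow> (\<And>x. x \<in> S \<Longrightarrow> F x = G x) \<Longrightarrow> C1_on S F \<Longrightarrow> C1_on S G"
  unfolding C1_on_iff_Ck_on by (rule Ck_on_cong)

lemma C1_onI:
  assumes "\<And>x. x \<in> S \<Longrightarrow> (F has_derivative F' x) (at x)" "\<And>v. continuous_on S (\<lambda>x. F' x v)"
  shows "C1_on S F"
  using assms unfolding C1_on_def by blast

lemma C1_onE:
  assumes "C1_on S F"
  obtains F' where "\<And>x. x \<in> S \<Longrightarrow> (F has_derivative F' x) (at x)"
    "\<And>v. continuous_on S (\<lambda>x. F' x v)" "continuous_on S F"
proof -
  obtain F' where F': "\<And>x. x \<in> S \<Longrightarrow> (F has_derivative F' x) (at x)"
    "\<And>v. continuous_on S (\<lambda>x. F' x v)" using assms unfolding C1_on_def by blast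
  moreover have "continuous_on S F"
    using F'(1) by (auto intro!: continuous_at_imp_continuous_on has_derivative_continuous)
  ultimately show thesis using that by blast
qed

lemma C1_on_continuous: "C1_on S F \<Longrightarrow> continuous_on S F"
  by (erule C1_onE)

lemma C1_on_frechet:
  assumes "C1_on S F" "x \<in> S"
  shows "(F has_derivative frechet_derivative F (at x)) (at x)"
  using assms unfolding C1_on_iff_Ck_on by (simp add: Ck_on.simps frechet_derivative_works)

lemma C1_on_partial_continuous:
  "C1_on S F \<Longrightarrow> continuous_on S (partial_deriv F i)"
  unfolding C1_on_iff_Ck_on by (simp add: Ck_on.simps partial_deriv_def[abs_def])

lemma C1_on_component:
  "open S \<Longrightarrow> C1_on S F \<Longrightarrow> C1_on S (\<lambda>x. F x $ i)"
  unfolding C1_on_iff_Ck_on by (rule Ck_on_bounded_linear[OF _ bounded_linear_vec_nth])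

lemma C1_on_const: "C1_on S (\<lambda>x. c)"
  by (rule C1_onI[where F' = "\<lambda>_ _. 0"]) auto

lemma C1_on_add:
  assumes "C1_on S F" "C1_on S G" shows "C1_on S (\<lambda>x. F x + G x)"
proof -
  obtain F' where "\<And>x. x \<in> S \<Longrightarrow> (F has_derivative F' x) (at x)"
    "\<And>v. continuous_on S (\<lambda>x. F' x v)" using C1_onE[OF assms(1)] by metis
  moreover obtain G' where "\<And>x. x \<in> S \<Longrightarrow> (G has_derivative G' x) (at x)"
    "\<And>v. continuous_on S (\<lambda>x. G' x v)" using C1_onE[OF assms(2)] by metis
  ultimately show ?thesis
    by (intro C1_onI[where F' = "\<lambda>x v. F' x v + G' x v"])
      (auto intro!: has_derivative_add continuous_intros)
qed

lemma C1_on_sum: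
  assumes "\<And>i. i \<in> I \<Longrightarrow> C1_on S (F i)" shows "C1_on S (\<lambda>x. \<Sum>i\<in>I. F i x)"
  using assms by (induction I rule: infinite_finite_induct) (auto intro!: C1_on_const C1_on_add)

lemma C1_on_mult:
  fixes F G :: "'a::real_normed_vector \<Rightarrow> real"
  assumes "C1_on S F" "C1_on S G" shows "C1_on S (\<lambda>x. F x * G x)"
proof -
  obtain F' where "\<And>x. x \<in> S \<Longrightarrow> (F has_derivative F' x) (at x)"
    "\<And>v. continuous_on S (\<lambda>x. F' x v)" "continuous_on S F" using C1_onE[OF assms(1)] by metis
  moreover obtain G' where "\<And>x. x \<in> S \<Longrightarrow> (G has_derivative G' x) (at x)"
    "\<And>v. continuous_on S (\<lambda>x. G' x v)" "continuous_on S G" using C1_onE[OF assms(2)] by metis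
  ultimately show ?thesis
    by (intro C1_onI[where F' = "\<lambda>x v. F x * G' x v + F' x v * G x"])
      (auto intro!: has_derivative_mult continuous_intros)
qed

lemma C1_on_prod:
  fixes F :: "'i \<Rightarrow> 'a::real_normed_vector \<Rightarrow> real"
  assumes "\<And>i. i \<in> I \<Longrightarrow> C1_on S (F i)" shows "C1_on S (\<lambda>x. \<Prod>i\<in>I. F i x)"
  using assms by (induction I rule: infinite_finite_induct) (auto intro!: C1_on_const C1_on_mult)

lemma C1_on_compose_real:
  fixes F :: "'a::real_normed_vector \<Rightarrow> real"
  assumes F: "C1_on S F"
    and r: "\<And>y. y \<in> R \<Longrightarrow> (r has_real_derivative r' y) (at y)" "continuous_on R r'"
    and SR: "\<And>x. x \<in> S \<Longrightarrow> F x \<in> R"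
  shows "C1_on S (\<lambda>x. r (F x))"
proof -
  obtain F' where F': "\<And>x. x \<in> S \<Longrightarrow> (F has_derivative F' x) (at x)"
    "\<And>v. continuous_on S (\<lambda>x. F' x v)" "continuous_on S F" using C1_onE[OF F] by metis
  show ?thesis
  proof (rule C1_onI)
    show "((\<lambda>x. r (F x)) has_derivative (\<lambda>v. r' (F x) * F' x v)) (at x)" if "x \<in> S" for x
      using has_derivative_compose[OF F'(1)[OF that], of r "\<lambda>v. r' (F x) * v"] r(1) SR[OF that]
      by (simp add: has_field_derivative_def)
    show "continuous_on S (\<lambda>x. r' (F x) * F' x v)" for v
      by (intro continuous_intros F' continuous_on_compose2[OF r(2)]) (use SR in auto)
  qed
qed

text \<open>
  The derivative of the outer map is continuous only for fixed directions, while the chain rule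
  applies it to a moving one; expanding the direction in a basis removes the difference.
\<close>

lemma C1_on_compose:
  fixes H :: "'a::real_normed_vector \<Rightarrow> 'b::euclidean_space" and F :: "'b \<Rightarrow> 'c::real_normed_vector"
  assumes F: "C1_on R F" and H: "C1_on S H" and SR: "\<And>x. x \<in> S \<Longrightarrow> H x \<in> R"
  shows "C1_on S (\<lambda>x. F (H x))"
proof -
  obtain F' where F': "\<And>x. x \<in> R \<Longrightarrow> (F has_derivative F' x) (at x)"
    "\<And>v. continuous_on R (\<lambda>x. F' x v)" using C1_onE[OF F] by metis
  obtain H' where H': "\<And>x. x \<in> S \<Longrightarrow> (H has_derivative H' x) (at x)"
    "\<And>v. continuous_on S (\<lambda>x. H' x v)" "continuous_on S H" using C1_onE[OF H] by metis
  have eq: "F' (H x) (H' x v) = (\<Sum>b\<in>Basis. (H' x v \<bullet> b) *\<^sub>R F' (H x) b)" if "x \<in> S" for x v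
  proof -
    have "linear (F' (H x))" using F'(1) SR[OF that] has_derivative_linear by blast
    then have "(\<Sum>b\<in>Basis. (H' x v \<bullet> b) *\<^sub>R F' (H x) b) = F' (H x) (\<Sum>b\<in>Basis. (H' x v \<bullet> b) *\<^sub>R b)"
      by (simp add: linear_sum linear_scale)
    then show ?thesis by (simp add: euclidean_representation)
  qed
  show ?thesis
  proof (rule C1_onI)
    show "((\<lambda>x. F (H x)) has_derivative (\<lambda>v. F' (H x) (H' x v))) (at x)" if "x \<in> S" for x
      using has_derivative_compose[OF H'(1)[OF that], of F "F' (H x)"] F'(1) SR[OF that] by simp
    have "continuous_on S (\<lambda>x. \<Sum>b\<in>Basis. (H' x v \<bullet> b) *\<^sub>R F' (H x) b)" for v
      by (intro continuous_intros H' continuous_on_compose2[OF F'(2)]) (use SR in auto)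
    then show "continuous_on S (\<lambda>x. F' (H x) (H' x v))" for v
      by (simp add: eq cong: continuous_on_cong)
  qed
qed

lemma C1_on_exp:
  fixes F :: "'a::real_normed_vector \<Rightarrow> real"
  assumes "C1_on S F" shows "C1_on S (\<lambda>x. exp (F x))"
  by (rule C1_on_compose_real[OF assms, of UNIV exp exp])
    (auto intro!: derivative_eq_intros continuous_intros)

lemma C1_on_sqrt:
  fixes F :: "'a::real_normed_vector \<Rightarrow> real"
  assumes "C1_on S F" "\<And>x. x \<in> S \<Longrightarrow> F x > 0" shows "C1_on S (\<lambda>x. sqrt (F x))"
  by (rule C1_on_compose_real[OF assms(1), of "{0<..}" sqrt "\<lambda>y. inverse (sqrt y) / 2"])
    (use assms in \<open>auto intro!: derivative_eq_intros continuous_intros\<close>)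

lemma C1_on_divide:
  fixes F G :: "'a::real_normed_vector \<Rightarrow> real"
  assumes "C1_on S F" "C1_on S G" "\<And>x. x \<in> S \<Longrightarrow> G x \<noteq> 0"
  shows "C1_on S (\<lambda>x. F x / G x)"
proof -
  have "C1_on S (\<lambda>x. inverse (G x))"
    by (rule C1_on_compose_real[OF assms(2), of "-{0}" inverse "\<lambda>y. - (inverse y ^ 2)"])
      (use assms in \<open>auto intro!: derivative_eq_intros continuous_intros simp: power2_eq_square\<close>)
  then show ?thesis using C1_on_mult[OF assms(1)] by (simp add: divide_inverse)
qed

lemma C1_on_det:
  fixes G :: "'a::real_normed_vector \<Rightarrow> real^'n^'n"
  assumes "\<And>i j. C1_on S (\<lambda>x. G x $ i $ j)" shows "C1_on S (\<lambda>x. det (G x))"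
  unfolding det_def by (intro C1_on_sum C1_on_mult C1_on_prod C1_on_const assms)

lemma matrix_inv_mult_vector:
  fixes G :: "real^'n^'n"
  assumes "invertible G"
  shows "G *v (matrix_inv G *v y) = y"
proof -
  have "G ** matrix_inv G = mat 1"
    using someI_ex[OF assms[unfolded invertible_def]] by (simp add: matrix_inv_def)
  then show ?thesis by (simp add: matrix_vector_mul_assoc)
qed

text \<open>
  By Cramer's rule the components are quotients of determinants.
\<close>

lemma C1_on_matrix_inv_mult:
  fixes G :: "'a::real_normed_vector \<Rightarrow> real^'n^'n"
  assumes S: "open S" and G: "\<And>i j. C1_on S (\<lambda>x. G x $ i $ j)" and y: "\<And>i. C1_on S (\<lambda>x. y x $ i)"
    and inv: "\<And>x. x \<in> S \<Longrightarrow> det (G x) \<noteq> 0"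
  shows "C1_on S (\<lambda>x. (matrix_inv (G x) *v y x) $ k)"
proof (rule C1_on_cong[OF S])
  show "det (\<chi> i j. if j = k then y x $ i else G x $ i $ j) / det (G x) = (matrix_inv (G x) *v y x) $ k"
    if "x \<in> S" for x
  proof -
    have "invertible (G x)" using inv[OF that] invertible_det_nz by blast
    then have "G x *v (matrix_inv (G x) *v y x) = y x"
      by (rule matrix_inv_mult_vector)
    then show ?thesis using cramer[OF inv[OF that], of "matrix_inv (G x) *v y x" "y x"]
      by (simp add: vec_eq_iff)
  qed
  have "C1_on S (\<lambda>x. if j = k then y x $ i else G x $ i $ j)" for i j
    using G y by (cases "j = k") auto
  then show "C1_on S (\<lambda>x. det (\<chi> i j. if j = k then y x $ i else G x $ i $ j) / det (G x))"
    by (intro C1_on_divide C1_on_det G inv) auto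
qed

lemma has_derivative_partial_derivs:
  fixes F :: "real^'n \<Rightarrow> real"
  assumes "F differentiable (at x)"
  shows "(F has_derivative (\<lambda>v. v \<bullet> (\<chi> j. partial_deriv F j x))) (at x)"
proof -
  have F: "(F has_derivative frechet_derivative F (at x)) (at x)"
    using assms by (simp add: frechet_derivative_works)
  then have l: "linear (frechet_derivative F (at x))" by (rule has_derivative_linear)
  have "frechet_derivative F (at x) v = v \<bullet> (\<chi> j. partial_deriv F j x)" for v
  proof -
    have "frechet_derivative F (at x) v = frechet_derivative F (at x) (\<Sum>i\<in>UNIV. v $ i *\<^sub>R axis i 1)"
      by (simp add: basis_expansion scalar_mult_eq_scaleR[symmetric])
    also have "\<dots> = v \<bullet> (\<chi> j. partial_deriv F j x)"
      by (simp add: linear_sum[OF l] linear_scale[OF l] inner_vec_def partial_deriv_def)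
    finally show ?thesis .
  qed
  then have "frechet_derivative F (at x) = (\<lambda>v. v \<bullet> (\<chi> j. partial_deriv F j x))" by (rule ext)
  with F show ?thesis by simp
qed

lemma partial_deriv_unique:
  assumes "(F has_derivative (\<lambda>v. v \<bullet> d)) (at x)"
  shows "partial_deriv F j x = d $ j"
  using frechet_derivative_at[OF assms, symmetric] by (simp add: partial_deriv_def inner_axis')

section \<open>Integrals of partial derivatives\<close>

lemma borel_integrable_compact_support:
  fixes h :: "'a::euclidean_space \<Rightarrow> real"
  assumes "continuous_on UNIV h" "compact K" "\<And>x. x \<notin> K \<Longrightarrow> h x = 0"
  shows "integrable lborel h"
proof -
  have "integrable lborel (\<lambda>x. indicator K x *\<^sub>R h x)"
    using borel_integrable_compact[OF assms(2) continuous_on_subset[OF assms(1)]]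
    by simp
  also have "(\<lambda>x. indicator K x *\<^sub>R h x) = h" using assms(3) by (auto simp: indicator_def fun_eq_iff)
  finally show ?thesis .
qed

text \<open>
  The integral of \<open>F (x + h e) - F x\<close> vanishes by translation invariance of Lebesgue measure. Divided
  by \<open>h\<close>, the integrand is bounded by \<open>sup \<bar>F' e\<bar>\<close>, vanishes off a fixed compact set and tends to
  \<open>F' e\<close> as \<open>h\<close> tends to \<open>0\<close>.
\<close>

lemma integral_partial_derivative_compact_support:
  fixes F :: "'a::euclidean_space \<Rightarrow> real"
  assumes D: "\<And>x. (F has_derivative F' x) (at x)" and c: "continuous_on UNIV (\<lambda>x. F' x e)"
    and K: "compact K" "\<And>x. x \<notin> K \<Longrightarrow> F x = 0"
  shows "(\<integral>x. F' x e \<partial>lborel) = 0"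
proof -
  have Fc: "continuous_on UNIV F"
    using D by (auto intro!: continuous_at_imp_continuous_on has_derivative_continuous)
  have F'0: "F' x e = 0" if "x \<notin> K" for x
  proof -
    have "((\<lambda>x. 0) has_derivative F' x) (at x)"
      by (rule has_derivative_transform_within_open[OF D, of "-K"])
        (use K that in \<open>auto intro: compact_imp_closed\<close>)
    then show ?thesis using has_derivative_unique[of "\<lambda>x. 0" "\<lambda>x. 0" x "F' x"] by (auto simp: fun_eq_iff)
  qed
  \<comment> \<open>contains the supports of all difference quotients with step at most \<open>1\<close>\<close>
  define K' where "K' = (\<lambda>(x, s). x - s *\<^sub>R e) ` (K \<times> {0..1::real})"
  have K': "compact K'" unfolding K'_def
    by (intro compact_continuous_image compact_Times K) (auto simp: case_prod_unfold intro!: continuous_intros)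
  obtain B where B: "\<And>x. \<bar>F' x e\<bar> \<le> B"
  proof -
    have "bounded ((\<lambda>x. F' x e) ` K)"
      by (intro compact_imp_bounded compact_continuous_image K continuous_on_subset[OF c]) auto
    then obtain B where B: "\<And>x. x \<in> K \<Longrightarrow> \<bar>F' x e\<bar> \<le> B" by (auto simp: bounded_iff)
    then have "\<bar>F' x e\<bar> \<le> max B 0" for x using F'0[of x] B[of x] by (cases "x \<in> K") force+
    then show thesis using that by blast
  qed
  define h where "h n = inverse (real (Suc n))" for n
  have h: "0 < h n" "h n \<le> 1" for n by (auto simp: h_def field_simps)
  define q where "q n x = (F (x + h n *\<^sub>R e) - F x) / h n" for n x
  have q0: "(\<integral>x. q n x \<partial>lborel) = 0" for n
  proof -
    have i: "integrable lborel F" by (rule borel_integrable_compact_support[OF Fc K])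
    have m: "(\<lambda>x. h n *\<^sub>R e + x) \<in> measurable lborel borel" by simp
    have mF: "F \<in> borel_measurable borel" using Fc by (rule borel_measurable_continuous_onI)
    have "(\<integral>x. F x \<partial>lborel) = (\<integral>x. F x \<partial>(distr lborel borel ((+) (h n *\<^sub>R e))))"
      by (simp add: lborel_distr_plus)
    also have "\<dots> = (\<integral>x. F (h n *\<^sub>R e + x) \<partial>lborel)" by (rule integral_distr[OF m mF])
    finally have *: "(\<integral>x. F (x + h n *\<^sub>R e) \<partial>lborel) = (\<integral>x. F x \<partial>lborel)" by (simp add: add.commute)
    have "integrable (distr lborel borel ((+) (h n *\<^sub>R e))) F" using i by (simp add: lborel_distr_plus)
    then have "integrable lborel (\<lambda>x. F (x + h n *\<^sub>R e))"
      by (subst (asm) integrable_distr_eq[OF m mF]) (simp add: add.commute)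
    with i * show ?thesis by (simp add: q_def)
  qed
  have Dl: "((\<lambda>s. F (x + s *\<^sub>R e)) has_real_derivative F' (x + s *\<^sub>R e) e) (at s)" for x s
  proof -
    have "((\<lambda>s. F (x + s *\<^sub>R e)) has_derivative (\<lambda>r. F' (x + s *\<^sub>R e) (r *\<^sub>R e))) (at s)"
      by (rule has_derivative_compose[of "\<lambda>s. x + s *\<^sub>R e" "\<lambda>s. s *\<^sub>R e"])
        (use D in \<open>auto intro!: derivative_eq_intros\<close>)
    then show ?thesis
      unfolding has_field_derivative_def
      using linear_scale[OF has_derivative_linear[OF D]] by (simp add: mult_commute_abs)
  qed
  have "(\<lambda>n. \<integral>x. q n x \<partial>lborel) \<longlonglongrightarrow> (\<integral>x. F' x e \<partial>lborel)"
  proof (rule integral_dominated_convergence[where w = "\<lambda>x. B * indicator K' x"])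
    show "(\<lambda>x. F' x e) \<in> borel_measurable lborel" using c by (simp add: borel_measurable_continuous_onI)
    show "q n \<in> borel_measurable lborel" for n unfolding q_def
      using Fc h[of n]
      by (auto intro!: borel_measurable_continuous_onI continuous_intros continuous_on_compose2[OF Fc])
    show "integrable lborel (\<lambda>x. B * indicator K' x)"
      using K' by (auto intro!: integrable_real_indicator emeasure_compact_finite simp: borel_compact)
    show "AE x in lborel. (\<lambda>n. q n x) \<longlonglongrightarrow> F' x e"
    proof (rule AE_I2)
      fix x
      have *: "(\<lambda>s. (F (x + s *\<^sub>R e) - F x) / s) \<midarrow>0\<rightarrow> F' x e"
        using Dl[of x 0] by (simp add: DERIV_def)
      have "filterlim h (at 0) sequentially"
        unfolding filterlim_at h_def using LIMSEQ_inverse_real_of_nat by auto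
      from filterlim_compose[OF * this] show "(\<lambda>n. q n x) \<longlonglongrightarrow> F' x e" by (simp add: q_def)
    qed
    show "AE x in lborel. norm (q n x) \<le> B * indicator K' x" for n
    proof (rule AE_I2)
      fix x
      obtain s where s: "0 < s" "s < h n" "F (x + h n *\<^sub>R e) - F x = h n * F' (x + s *\<^sub>R e) e"
        using MVT2[OF h(1)[of n], of "\<lambda>s. F (x + s *\<^sub>R e)" "\<lambda>s. F' (x + s *\<^sub>R e) e"] Dl by auto
      have q: "q n x = F' (x + s *\<^sub>R e) e" using s(3) h(1)[of n] by (simp add: q_def)
      show "norm (q n x) \<le> B * indicator K' x"
      proof (cases "x + s *\<^sub>R e \<in> K")
        case True
        have "x = (\<lambda>(x, s). x - s *\<^sub>R e) (x + s *\<^sub>R e, s)" by simp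
        then have "x \<in> K'" unfolding K'_def using True s h(2)[of n]
          by (intro image_eqI[where x = "(x + s *\<^sub>R e, s)"]) auto
        then show ?thesis using B q by simp
      next
        case False
        have "0 \<le> B" using B[of x] by linarith
        then show ?thesis using q F'0[OF False] by (simp add: indicator_def)
      qed
    qed
  qed
  with q0 show ?thesis by (simp add: LIMSEQ_const_iff)
qed

text \<open>
  The version for coordinate domains: a function on \<open>S\<close> with compact support in \<open>S\<close> is extended by zero.
\<close>

lemma integral_partial_derivative_open:
  fixes F :: "'a::euclidean_space \<Rightarrow> real"
  assumes S: "open S" and F: "C1_on S F" and K: "compact K" "K \<subseteq> S" "\<And>x. x \<in> S \<Longrightarrow> x \<notin> K \<Longrightarrow> F x = 0"
  shows "integrable lborel (\<lambda>x. if x \<in> S then frechet_derivative F (at x) e else 0)" (is ?I)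
    and "(\<integral>x. (if x \<in> S then frechet_derivative F (at x) e else 0) \<partial>lborel) = 0" (is ?Z)
proof -
  define G where "G x = (if x \<in> S then F x else 0)" for x
  have oK: "open (- K)" using K by (simp add: compact_imp_closed open_Compl)
  have G0: "G x = 0" if "x \<notin> K" for x using K(3) that by (simp add: G_def)
  have "C1_on S G" by (rule C1_on_cong[OF S _ F]) (simp add: G_def)
  moreover have "C1_on (- K) G" by (rule C1_on_cong[OF oK _ C1_on_const[of _ 0]]) (simp add: G0)
  ultimately have "Ck_on (Suc 0) UNIV G"
    using S oK K(2) unfolding C1_on_iff_Ck_on by (intro Ck_on_local) blast
  then have G: "\<And>x. (G has_derivative frechet_derivative G (at x)) (at x)"
    "continuous_on UNIV (\<lambda>x. frechet_derivative G (at x) e)"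
    by (auto simp: Ck_on.simps frechet_derivative_works)
  have in_S: "frechet_derivative G (at x) = frechet_derivative F (at x)" if "x \<in> S" for x
  proof -
    have "(F has_derivative frechet_derivative G (at x)) (at x)"
      by (rule has_derivative_transform_within_open[OF G(1) S that]) (simp add: G_def)
    then show ?thesis by (rule frechet_derivative_at)
  qed
  have off_K: "frechet_derivative G (at x) e = 0" if "x \<notin> K" for x
  proof -
    have "(G has_derivative (\<lambda>v. 0)) (at x)"
      by (rule has_derivative_transform_within_open[OF has_derivative_const[of 0] oK]) (use that in \<open>auto simp: G0\<close>)
    from frechet_derivative_at[OF this] show ?thesis by metis
  qed
  have eq: "(\<lambda>x. frechet_derivative G (at x) e) = (\<lambda>x. if x \<in> S then frechet_derivative F (at x) e else 0)"
    using in_S off_K K(2) by (auto simp: fun_eq_iff)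
  show ?I unfolding eq[symmetric] by (rule borel_integrable_compact_support[OF G(2) K(1) off_K])
  show ?Z unfolding eq[symmetric] by (rule integral_partial_derivative_compact_support[OF G K(1) G0])
qed

section \<open>Integrals depending on a parameter and log-convexity\<close>

lemma DERIV_affine_within:
  fixes w :: "real \<Rightarrow> real"
  assumes "(w has_real_derivative D) (at (m + e * s) within S)" "(\<lambda>s. m + e * s) ` R \<subseteq> S"
  shows "((\<lambda>s. w (m + e * s)) has_real_derivative D * e) (at s within R)"
proof -
  have "((\<lambda>s. m + e * s) has_real_derivative e) (at s within R)" by (auto intro!: derivative_eq_intros)
  from DERIV_image_chain[OF DERIV_subset[OF assms] this] show ?thesis by (simp add: comp_def)
qed

text \<open>
  The mean value theorem bounds the difference quotients by \<open>B\<close>, so that dominated convergence applies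
  on a finite measure space.
\<close>

lemma has_derivative_integral_bounded:
  fixes k k' :: "'a \<Rightarrow> real \<Rightarrow> real"
  assumes M: "finite_measure M" and s: "s \<in> {a..b}"
    and D: "\<And>p t. t \<in> {a..b} \<Longrightarrow> (k p has_real_derivative k' p t) (at t within {a..b})"
    and B: "\<And>p t. t \<in> {a..b} \<Longrightarrow> \<bar>k' p t\<bar> \<le> B"
    and int: "\<And>t. t \<in> {a..b} \<Longrightarrow> integrable M (\<lambda>p. k p t)"
    and meas: "(\<lambda>p. k' p s) \<in> borel_measurable M"
  shows "((\<lambda>t. \<integral>p. k p t \<partial>M) has_real_derivative (\<integral>p. k' p s \<partial>M)) (at s within {a..b})"
  unfolding has_field_derivative_iff tendsto_at_iff_sequentially comp_def
proof (intro allI impI)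
  interpret finite_measure M by (rule M)
  fix X :: "nat \<Rightarrow> real" assume X: "\<forall>i. X i \<in> {a..b} - {s}" "X \<longlonglongrightarrow> s"
  have Xi: "X i \<in> {a..b}" "X i \<noteq> s" for i using X(1) by auto
  have "(\<lambda>i. \<integral>p. (k p (X i) - k p s) / (X i - s) \<partial>M) \<longlonglongrightarrow> (\<integral>p. k' p s \<partial>M)"
  proof (rule integral_dominated_convergence[where w = "\<lambda>_. B"])
    show "(\<lambda>p. (k p (X i) - k p s) / (X i - s)) \<in> borel_measurable M" for i
      using int[OF Xi(1)[of i]] int[OF s] by measurable
    show "AE p in M. (\<lambda>i. (k p (X i) - k p s) / (X i - s)) \<longlonglongrightarrow> k' p s"
      using D[OF s, unfolded has_field_derivative_iff tendsto_at_iff_sequentially comp_def] X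
      by (intro AE_I2) blast
    show "AE p in M. norm ((k p (X i) - k p s) / (X i - s)) \<le> B" for i
    proof (rule AE_I2)
      fix p
      have "norm (k p (X i) - k p s) \<le> B * norm (X i - s)"
        by (rule field_differentiable_bound[of "{a..b}" "k p" "k' p"]) (use D B s Xi in auto)
      then show "norm ((k p (X i) - k p s) / (X i - s)) \<le> B"
        using Xi(2)[of i] by (simp add: divide_le_eq)
    qed
  qed (use meas in auto)
  also have "(\<lambda>i. \<integral>p. (k p (X i) - k p s) / (X i - s) \<partial>M)
      = (\<lambda>i. ((\<integral>p. k p (X i) \<partial>M) - (\<integral>p. k p s \<partial>M)) / (X i - s))"
    using int Xi s by simp
  finally show "(\<lambda>i. ((\<integral>p. k p (X i) \<partial>M) - (\<integral>p. k p s \<partial>M)) / (X i - s)) \<longlonglongrightarrow> (\<integral>p. k' p s \<partial>M)" .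
qed

lemma integral_Cauchy_Schwarz:
  fixes h k :: "'a \<Rightarrow> real"
  assumes "integrable M (\<lambda>p. (h p)\<^sup>2)" "integrable M (\<lambda>p. (k p)\<^sup>2)" "integrable M (\<lambda>p. h p * k p)"
  shows "(\<integral>p. h p * k p \<partial>M)\<^sup>2 \<le> (\<integral>p. (h p)\<^sup>2 \<partial>M) * (\<integral>p. (k p)\<^sup>2 \<partial>M)"
proof -
  define F G C where "F = (\<integral>p. (h p)\<^sup>2 \<partial>M)" and "G = (\<integral>p. (k p)\<^sup>2 \<partial>M)" and "C = (\<integral>p. h p * k p \<partial>M)"
  have q: "0 \<le> l\<^sup>2 * F + 2 * l * C + G" for l
  proof -
    have "0 \<le> (\<integral>p. (l * h p + k p)\<^sup>2 \<partial>M)" by simp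
    also have "\<dots> = (\<integral>p. l\<^sup>2 * (h p)\<^sup>2 + 2 * l * (h p * k p) + (k p)\<^sup>2 \<partial>M)"
      by (intro Bochner_Integration.integral_cong) (auto simp: power2_eq_square algebra_simps)
    also have "\<dots> = l\<^sup>2 * F + 2 * l * C + G" using assms by (simp add: F_def G_def C_def)
    finally show ?thesis .
  qed
  have "C\<^sup>2 \<le> F * G"
  proof (cases "F = 0")
    case True
    have "C = 0"
    proof (rule ccontr)
      assume "C \<noteq> 0"
      \<comment> \<open>for \<open>F = 0\<close> the quadratic in \<open>l\<close> is affine and takes the value \<open>-1\<close> here\<close>
      then show False using q[of "- (G + 1) / (2 * C)"] True by (simp add: field_simps)
    qed
    then show ?thesis using True by simp
  next
    case False
    moreover have "F \<ge> 0" by (simp add: F_def)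
    ultimately have "F > 0" by simp
    \<comment> \<open>\<open>l = - C / F\<close> minimises the quadratic\<close>
    have "0 \<le> F * ((- C / F)\<^sup>2 * F + 2 * (- C / F) * C + G)"
      by (intro mult_nonneg_nonneg q) (use \<open>F > 0\<close> in simp)
    also have "\<dots> = F * G - C\<^sup>2" using \<open>F > 0\<close> by (simp add: power2_eq_square field_simps)
    finally show ?thesis by simp
  qed
  then show ?thesis by (simp add: F_def G_def C_def)
qed

text \<open>
  A convex function lies above its tangents. In the midpoint form, with \<open>r = J / J a\<close>, the inequality
  \<open>(r (a + h))\<^sup>2 \<le> r (a + 2 h)\<close> doubles the step; after \<open>n\<close> doublings of the step \<open>(b - a) / 2\<^sup>n\<close> the
  point \<open>b\<close> is reached, and the differentiability at \<open>a\<close> gives the limit.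
\<close>

lemma midpoint_log_convex_tangent:
  fixes J :: "real \<Rightarrow> real"
  assumes ab: "a < b" and pos: "J a > 0" and nonneg: "\<And>t. J t \<ge> 0"
    and D: "(J has_real_derivative D) (at a within {a..b})"
    and mid: "\<And>m h. 0 \<le> h \<Longrightarrow> a \<le> m - h \<Longrightarrow> m + h \<le> b \<Longrightarrow> (J m)\<^sup>2 \<le> J (m - h) * J (m + h)"
  shows "J a * exp (D / J a * (b - a)) \<le> J b"
proof -
  define r where "r t = J t / J a" for t
  \<comment> \<open>midpoint convexity between \<open>a\<close> and \<open>a + 2 ^ Suc n * h\<close> gives the induction step\<close>
  have dyadic: "r (a + h) ^ (2 ^ n) \<le> r (a + 2 ^ n * h)" if "0 \<le> h" "a + 2 ^ n * h \<le> b" for n h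
    using that(2)
  proof (induction n)
    case (Suc n)
    have h': "0 \<le> 2 ^ n * h" using that by simp
    have "(J (a + 2 ^ n * h))\<^sup>2 \<le> J a * J (a + 2 ^ Suc n * h)"
      using mid[of "2 ^ n * h" "a + 2 ^ n * h"] Suc.prems h' by (simp add: algebra_simps)
    then have *: "(r (a + 2 ^ n * h))\<^sup>2 \<le> r (a + 2 ^ Suc n * h)"
      using pos by (simp add: r_def power2_eq_square field_simps)
    have "r (a + h) ^ (2 ^ Suc n) = (r (a + h) ^ (2 ^ n))\<^sup>2"
      by (simp add: power_mult[symmetric] mult.commute)
    also have "\<dots> \<le> (r (a + 2 ^ n * h))\<^sup>2"
      using Suc h' nonneg pos by (intro power_mono) (auto simp: r_def)
    finally show ?case using * by simp
  qed simp
  define h where "h n = (b - a) / 2 ^ n" for n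
  have h: "h n > 0" "2 ^ n * h n = b - a" for n using ab by (auto simp: h_def)
  have hab: "a + h n \<in> {a..b} - {a}" for n
  proof -
    have "h n * 1 \<le> h n * 2 ^ n" using h(1)[of n] by (intro mult_left_mono) auto
    then have "h n \<le> b - a" using h(2)[of n] by (simp add: mult.commute)
    then show ?thesis using h(1)[of n] ab by simp
  qed
  have "(\<lambda>n. (b - a) * (1 / 2) ^ n) \<longlonglongrightarrow> (b - a) * 0" by (intro tendsto_intros LIMSEQ_power_zero) auto
  then have h0: "h \<longlonglongrightarrow> 0" by (simp add: h_def[abs_def] power_divide)
  have ah: "(\<lambda>n. a + h n) \<longlonglongrightarrow> a" using tendsto_add[OF tendsto_const h0, of a] by simp
  have ra: "r a = 1" using pos by (simp add: r_def)
  have rD: "(r has_real_derivative D / J a) (at a within {a..b})"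
    unfolding r_def using D pos by (auto intro!: derivative_eq_intros)
  have lnD: "((\<lambda>t. ln (r t)) has_real_derivative D / J a) (at a within {a..b})"
    using DERIV_chain2[OF _ rD, of ln 1] DERIV_ln[of 1] by (simp add: ra)
  have lim: "(\<lambda>n. ln (r (a + h n)) / h n) \<longlonglongrightarrow> D / J a"
    using lnD[unfolded has_field_derivative_iff tendsto_at_iff_sequentially comp_def, rule_format, OF hab ah]
    by (simp add: ra)
  have "(\<lambda>n. exp (ln (r (a + h n)) / h n * (b - a))) \<longlonglongrightarrow> exp (D / J a * (b - a))"
    by (intro tendsto_intros lim)
  moreover have "\<forall>\<^sub>F n in sequentially. exp (ln (r (a + h n)) / h n * (b - a)) \<le> r b"
  proof -
    have "(r \<longlongrightarrow> r a) (at a within {a..b})"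
      using has_field_derivative_imp_has_derivative[OF rD] has_derivative_continuous
      unfolding continuous_within by blast
    from this[unfolded tendsto_at_iff_sequentially comp_def, rule_format, OF hab ah]
    have "(\<lambda>n. r (a + h n)) \<longlonglongrightarrow> 1" by (simp add: ra)
    then have "\<forall>\<^sub>F n in sequentially. r (a + h n) > 0" by (rule order_tendstoD) simp
    then show ?thesis
    proof eventually_elim
      case (elim n)
      have "exp (ln (r (a + h n)) / h n * (b - a)) = exp (real (2 ^ n) * ln (r (a + h n)))"
        by (subst h(2)[of n, symmetric]) (use h(1)[of n] in simp)
      also have "\<dots> = r (a + h n) ^ (2 ^ n)" using elim by (simp only: exp_of_nat_mult exp_ln)
      also have "\<dots> \<le> r b" using dyadic[of "h n" n] h[of n] by simp
      finally show ?case .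
    qed
  qed
  ultimately have "exp (D / J a * (b - a)) \<le> r b"
    using tendsto_upperbound by (metis sequentially_bot)
  then show ?thesis using pos by (simp add: r_def field_simps)
qed

section \<open>Determinants, cut-offs and measurability in coordinates\<close>

text \<open>
  On the segment from the identity to \<open>G\<close> all matrices are positive definite, so the determinant does
  not vanish on it, and it starts at \<open>1\<close>.
\<close>

lemma det_pos_if_pos_def:
  fixes G :: "real^'n^'n"
  assumes "\<And>v. v \<noteq> 0 \<Longrightarrow> v \<bullet> (G *v v) > 0"
  shows "det G > 0"
proof (rule ccontr)
  assume neg: "\<not> det G > 0"
  define H where "H s = (1 - s) *\<^sub>R mat 1 + s *\<^sub>R G" for s :: real
  have nz: "det (H s) \<noteq> 0" if "0 \<le> s" "s \<le> 1" for s
  proof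
    assume "det (H s) = 0"
    then have "\<not> inj ((*v) (H s))" using det_nz_iff_inj[OF matrix_vector_mul_linear, of "H s"] by simp
    then obtain x y where "x \<noteq> y" "H s *v x = H s *v y" by (auto simp: inj_def)
    then obtain v where v: "v \<noteq> 0" "H s *v v = 0"
      by (metis matrix_vector_mult_diff_distrib right_minus_eq)
    have "v \<bullet> (H s *v v) = (1 - s) * (v \<bullet> v) + s * (v \<bullet> (G *v v))"
      by (simp add: H_def matrix_vector_mult_add_rdistrib inner_add_right scaleR_matrix_vector_assoc[symmetric])
    moreover have "(1 - s) * (v \<bullet> v) + s * (v \<bullet> (G *v v)) > 0"
    proof (cases "s = 0")
      case False
      then have "s * (v \<bullet> (G *v v)) > 0" "(1 - s) * (v \<bullet> v) \<ge> 0" using that assms v by auto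
      then show ?thesis by linarith
    qed (use v in auto)
    ultimately show False using v by simp
  qed
  have "continuous_on {0..1} (\<lambda>s. det (H s))"
    unfolding det_def H_def by (intro continuous_intros)
  then obtain s where "0 \<le> s" "s \<le> 1" "det (H s) = 0"
    using IVT2'[of "\<lambda>s. det (H s)" 1 0 0] neg by (auto simp: H_def)
  then show False using nz by blast
qed

text \<open>
  Only one derivative of the cut-off functions is ever taken, so the square of the positive part of a
  quadratic polynomial will do.
\<close>

lemma bump_C1: "C1_on UNIV (\<lambda>x::real^'k. (max 0 (r - (x - x0) \<bullet> (x - x0)))\<^sup>2)"
proof (rule C1_on_compose_real[where F = "\<lambda>x. r - (x - x0) \<bullet> (x - x0)" and R = UNIV
      and r = "\<lambda>y. (max 0 y)\<^sup>2" and r' = "\<lambda>y. 2 * max 0 y"])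
  show "C1_on UNIV (\<lambda>x. r - (x - x0) \<bullet> (x - x0))"
    by (rule C1_onI[where F' = "\<lambda>x v. - (2 * ((x - x0) \<bullet> v))"])
      (auto intro!: derivative_eq_intros continuous_intros simp: inner_commute fun_eq_iff)
  show "((\<lambda>y::real. (max 0 y)\<^sup>2) has_real_derivative 2 * max 0 y) (at y)" for y
  proof (cases y "0::real" rule: linorder_cases)
    case less
    have "((\<lambda>y. 0) has_real_derivative 2 * max 0 y) (at y)" using less by simp
    then show ?thesis
      by (rule has_field_derivative_transform_within_open[of _ _ _ "{..<0}"]) (use less in auto)
  next
    case greater
    have "((\<lambda>y. y\<^sup>2) has_real_derivative 2 * max 0 y) (at y)"
      using greater by (auto intro!: derivative_eq_intros)
    then show ?thesis
      by (rule has_field_derivative_transform_within_open[of _ _ _ "{0<..}"]) (use greater in auto)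
  next
    case equal
    have "((\<lambda>h::real. (max 0 h)\<^sup>2 / h) \<longlongrightarrow> 0) (at 0)"
    proof (rule Lim_null_comparison)
      show "\<forall>\<^sub>F h in at (0::real). norm ((max 0 h)\<^sup>2 / h) \<le> \<bar>h\<bar>"
        by (rule always_eventually) (auto simp: max_def power2_eq_square)
      show "((\<lambda>h. \<bar>h\<bar>) \<longlongrightarrow> 0) (at (0::real))" by (intro tendsto_eq_intros) auto
    qed
    then show ?thesis using equal by (simp add: DERIV_def)
  qed
qed (auto intro!: continuous_intros)

lemma measurable_if_open:
  assumes "open S" "continuous_on S F"
  shows "(\<lambda>x. if x \<in> S then F x else k) \<in> borel_measurable borel"
  by (rule borel_measurable_continuous_on_if) (use assms in auto)

section \<open>Charts\<close>

definition Ck_fun :: "('m, 'n::finite) chart set \<Rightarrow> nat \<Rightarrow> ('m \<Rightarrow> real) \<Rightarrow> bool" where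
  "Ck_fun A k h \<longleftrightarrow> (\<forall>c\<in>A. Ck_on k (chart_img c) (\<lambda>x. h (chart_inv c x)))"

definition chart_differential :: "('m, 'n::finite) chart \<Rightarrow> ('m \<Rightarrow> real) \<Rightarrow> 'm \<Rightarrow> real ^ 'n" where
  "chart_differential c h p =
     (\<chi> j. partial_deriv (\<lambda>x. h (chart_inv c x)) j (chart_map c p))"

text \<open>
  The density \<open>\<langle>T (\<nabla> z), \<nabla> w\<rangle>\<close> in coordinates. The metric cancels against its inverse in the gradient
  of \<open>w\<close>, which leaves the pairing of a vector with the differential of \<open>w\<close>.
\<close>

definition chart_energy :: "('m, 'n::finite) tensor_components \<Rightarrow> ('m, 'n) tensor_components \<Rightarrow>
    ('m, 'n) chart \<Rightarrow> ('m \<Rightarrow> real) \<Rightarrow> ('m \<Rightarrow> real) \<Rightarrow> 'm \<Rightarrow> real" where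
  "chart_energy g T c z w p = (T c p *v gradient g z c p) \<bullet> chart_differential c w p"

lemma gradient_eq: "gradient g h c p = matrix_inv (g c p) *v chart_differential c h p"
  by (simp add: gradient_def chart_differential_def)

locale closed_weighted_manifold =
  fixes A :: "('m::t2_space, 'n::finite) chart set"
    and g T :: "('m, 'n) tensor_components"
    and \<nu> :: "'m measure"
    and f :: "'m \<Rightarrow> real"
  assumes compact_space: "compact (UNIV :: 'm set)"
    and atlas: "smooth_atlas A"
    and metric: "riemannian_metric A g"
    and volume: "riemannian_volume A g \<nu>"
    and potential: "smooth_fun A f"
    and tensor: "smooth_tensor11 A T"
    and tensor_sym: "symmetric_tensor11 A g T"
begin

lemma
  assumes "c \<in> A"
  shows open_dom: "open (chart_dom c)" and open_img: "open (chart_img c)"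
    and inv_map: "p \<in> chart_dom c \<Longrightarrow> chart_inv c (chart_map c p) = p"
    and map_inv: "x \<in> chart_img c \<Longrightarrow> chart_map c (chart_inv c x) = x"
    and inv_in_dom: "x \<in> chart_img c \<Longrightarrow> chart_inv c x \<in> chart_dom c"
    and map_in_img: "p \<in> chart_dom c \<Longrightarrow> chart_map c p \<in> chart_img c"
    and continuous_map: "continuous_on (chart_dom c) (chart_map c)"
    and continuous_inv: "continuous_on (chart_img c) (chart_inv c)"
proof -
  have h: "homeomorphism (chart_dom c) (chart_img c) (chart_map c) (chart_inv c)"
    and "open (chart_dom c)" "open (chart_img c)"
    using atlas assms unfolding smooth_atlas_def by blast+
  then show "open (chart_dom c)" "open (chart_img c)" by blast+
  show "p \<in> chart_dom c \<Longrightarrow> chart_inv c (chart_map c p) = p"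
    "x \<in> chart_img c \<Longrightarrow> chart_map c (chart_inv c x) = x"
    "x \<in> chart_img c \<Longrightarrow> chart_inv c x \<in> chart_dom c"
    "p \<in> chart_dom c \<Longrightarrow> chart_map c p \<in> chart_img c"
    "continuous_on (chart_dom c) (chart_map c)" "continuous_on (chart_img c) (chart_inv c)"
    using h unfolding homeomorphism_def by auto
qed

lemma chart_cover: obtains c where "c \<in> A" "p \<in> chart_dom c"
  using atlas unfolding smooth_atlas_def by blast

lemma chart_at: "chart_at A p \<in> A" "p \<in> chart_dom (chart_at A p)"
  using someI_ex[of "\<lambda>c. c \<in> A \<and> p \<in> chart_dom c"] chart_cover[of p] unfolding chart_at_def by metis+

lemma image_chart: "c \<in> A \<Longrightarrow> chart_map c ` (chart_dom c \<inter> U) = chart_img c \<inter> chart_inv c -` U"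
  by (auto simp: map_inv inv_map inv_in_dom map_in_img intro!: image_eqI[where x = "chart_inv c _"])

lemma open_image_chart: "c \<in> A \<Longrightarrow> open U \<Longrightarrow> open (chart_map c ` (chart_dom c \<inter> U))"
  unfolding image_chart by (rule continuous_open_preimage[OF continuous_inv open_img])

lemma transition_Ck:
  "c \<in> A \<Longrightarrow> d \<in> A \<Longrightarrow>
    Ck_on k (chart_map c ` (chart_dom c \<inter> chart_dom d)) (\<lambda>x. chart_map d (chart_inv c x))"
  using atlas smooth_on_imp_Ck_on open_image_chart open_dom unfolding smooth_atlas_def by blast

lemma continuous_on_dom:
  assumes "c \<in> A" "continuous_on (chart_img c) (\<lambda>x. h (chart_inv c x))"
  shows "continuous_on (chart_dom c) h"
proof -
  have "continuous_on (chart_dom c) (\<lambda>p. h (chart_inv c (chart_map c p)))"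
    using map_in_img[OF assms(1)]
    by (intro continuous_on_compose2[OF assms(2) continuous_map[OF assms(1)]]) auto
  then show ?thesis by (rule continuous_on_eq) (simp add: inv_map[OF assms(1)])
qed

lemma continuous_on_manifold:
  assumes "\<And>c. c \<in> A \<Longrightarrow> continuous_on (chart_dom c) h"
  shows "continuous_on UNIV h"
proof (rule continuous_on_local)
  fix p :: 'm
  obtain c where "c \<in> A" "p \<in> chart_dom c" by (rule chart_cover)
  then show "\<exists>W. open W \<and> p \<in> W \<and> continuous_on (UNIV \<inter> W) h" using assms open_dom
    by (intro exI[of _ "chart_dom c"]) simp
qed

lemma Ck_fun_continuous: "Ck_fun A (Suc k) h \<Longrightarrow> continuous_on UNIV h"
proof (induction k)
  case 0
  show ?case
    by (rule continuous_on_manifold, rule continuous_on_dom)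
       (use 0 in \<open>metis Ck_fun_def Ck_on_Suc_imp Ck_on.simps(1)\<close>)+
next
  case (Suc k)
  then show ?case by (auto simp: Ck_fun_def dest: Ck_on_Suc_imp)
qed

lemma smooth_fun_Ck: "smooth_fun A h \<Longrightarrow> Ck_fun A k h"
  by (simp add: smooth_fun_def Ck_fun_def smooth_on_imp_Ck_on open_img)

lemma C1_fun_iff: "Ck_fun A (Suc 0) h \<longleftrightarrow> (\<forall>c\<in>A. C1_on (chart_img c) (\<lambda>x. h (chart_inv c x)))"
  by (simp add: Ck_fun_def C1_on_iff_Ck_on)

section \<open>The energy density does not depend on the chart\<close>

lemma chart_has_derivative:
  assumes "Ck_fun A (Suc k) h" "c \<in> A" "p \<in> chart_dom c"
  shows "((\<lambda>x. h (chart_inv c x)) has_derivative (\<lambda>v. v \<bullet> chart_differential c h p)) (at (chart_map c p))"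
  unfolding chart_differential_def
  by (rule has_derivative_partial_derivs)
     (use assms map_in_img in \<open>auto simp: Ck_fun_def Ck_on.simps\<close>)

lemma chart_differential_eqI:
  assumes "((\<lambda>x. h (chart_inv c x)) has_derivative (\<lambda>v. v \<bullet> d)) (at (chart_map c p))"
  shows "chart_differential c h p = d"
  using partial_deriv_unique[OF assms] by (simp add: chart_differential_def vec_eq_iff)

lemma chart_differential_transform:
  assumes h: "Ck_fun A (Suc k) h" and c: "c \<in> A" "p \<in> chart_dom c" and d: "d \<in> A" "p \<in> chart_dom d"
  shows "chart_differential c h p = transpose (transition_jacobian c d p) *v chart_differential d h p"
proof (rule chart_differential_eqI)
  let ?J = "transition_jacobian c d p" and ?W = "chart_map c ` (chart_dom c \<inter> chart_dom d)"
  let ?\<tau> = "\<lambda>x. chart_map d (chart_inv c x)"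
  have W: "chart_map c p \<in> ?W" using c d by auto
  have "?\<tau> differentiable (at (chart_map c p))"
    using transition_Ck[OF c(1) d(1), of "Suc 0"] W by (auto simp: Ck_on.simps)
  then have J: "(?\<tau> has_derivative (\<lambda>v. ?J *v v)) (at (chart_map c p))"
    unfolding transition_jacobian_def by (simp add: jacobian_works[symmetric])
  have "((\<lambda>x. h (chart_inv d (?\<tau> x))) has_derivative (\<lambda>v. (?J *v v) \<bullet> chart_differential d h p)) (at (chart_map c p))"
    by (rule has_derivative_compose[OF J])
      (use chart_has_derivative[OF h d] c in \<open>simp add: inv_map\<close>)
  then have "((\<lambda>x. h (chart_inv c x)) has_derivative (\<lambda>v. (?J *v v) \<bullet> chart_differential d h p)) (at (chart_map c p))"
    by (rule has_derivative_transform_within_open[OF _ open_image_chart[OF c(1) open_dom[OF d(1)]] W])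
      (use c(1) d(1) in \<open>auto simp: inv_map\<close>)
  also have "(\<lambda>v. (?J *v v) \<bullet> chart_differential d h p) = (\<lambda>v. v \<bullet> (transpose ?J *v chart_differential d h p))"
    by (simp add: dot_lmul_matrix[symmetric] inner_commute transpose_matrix_vector)
  finally show "((\<lambda>x. h (chart_inv c x)) has_derivative (\<lambda>v. v \<bullet> (transpose ?J *v chart_differential d h p))) (at (chart_map c p))" .
qed

lemma metric_pos_def:
  assumes "c \<in> A" "p \<in> chart_dom c" "v \<noteq> 0"
  shows "v \<bullet> (g c p *v v) > 0"
  using metric assms unfolding riemannian_metric_def by blast

lemma
  assumes "c \<in> A" "p \<in> chart_dom c"
  shows metric_symmetric: "transpose (g c p) = g c p"
    and metric_det_pos: "det (g c p) > 0"
    and metric_gradient: "g c p *v gradient g h c p = chart_differential c h p"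
proof -
  show "transpose (g c p) = g c p" using metric assms unfolding riemannian_metric_def by blast
  show d: "det (g c p) > 0"
    by (rule det_pos_if_pos_def) (rule metric_pos_def[OF assms])
  then have "invertible (g c p)" by (simp add: invertible_det_nz)
  then show "g c p *v gradient g h c p = chart_differential c h p"
    by (simp add: gradient_eq matrix_inv_mult_vector)
qed

lemma metric_injective:
  assumes "c \<in> A" "p \<in> chart_dom c" "g c p *v v = g c p *v w"
  shows "v = w"
proof (rule ccontr)
  assume "v \<noteq> w"
  then have "(v - w) \<bullet> (g c p *v (v - w)) > 0"
    using metric_pos_def[OF assms(1,2)] by simp
  then show False using assms(3) by (simp add: matrix_vector_mult_diff_distrib)
qed

text \<open>
  With \<open>J\<close> the Jacobian of the change of charts, differentials transform by the transpose of \<open>J\<close> and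
  the metric by \<open>g\<^sub>c = J\<^sup>T g\<^sub>d J\<close>, which also shows that \<open>J\<close> is invertible. So both sides have the
  same image under \<open>J\<^sup>T g\<^sub>d\<close>.
\<close>

lemma gradient_transform:
  assumes h: "Ck_fun A (Suc k) h" and c: "c \<in> A" "p \<in> chart_dom c" and d: "d \<in> A" "p \<in> chart_dom d"
  shows "gradient g h d p = transition_jacobian c d p *v gradient g h c p"
proof (rule metric_injective[OF d])
  let ?J = "transition_jacobian c d p"
  have gc: "g c p = transpose ?J ** g d p ** ?J"
    using metric c d unfolding riemannian_metric_def by blast
  have "det (g c p) = det (transpose ?J) * det (g d p) * det ?J" by (simp add: gc det_mul)
  then have "det (transpose ?J) \<noteq> 0" using metric_det_pos[OF c] by auto
  then have inj: "inj ((*v) (transpose ?J))"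
    using inj_matrix_vector_mult invertible_det_nz by blast
  have "transpose ?J *v (g d p *v (?J *v gradient g h c p)) = g c p *v gradient g h c p"
    by (simp add: gc matrix_vector_mul_assoc matrix_mul_assoc)
  also have "\<dots> = transpose ?J *v (g d p *v gradient g h d p)"
    by (simp only: metric_gradient[OF c] metric_gradient[OF d] chart_differential_transform[OF h c d])
  finally show "g d p *v gradient g h d p = g d p *v (?J *v gradient g h c p)"
    using injD[OF inj] by metis
qed

lemma chart_energy_indep:
  assumes z: "Ck_fun A (Suc k) z" and w: "Ck_fun A (Suc k) w"
    and c: "c \<in> A" "p \<in> chart_dom c" and d: "d \<in> A" "p \<in> chart_dom d"
  shows "chart_energy g T c z w p = chart_energy g T d z w p"
proof -
  let ?J = "transition_jacobian c d p"
  have TJ: "T d p ** ?J = ?J ** T c p" using tensor c d unfolding smooth_tensor11_def by blast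
  have "chart_energy g T c z w p
      = (T c p *v gradient g z c p) \<bullet> (transpose ?J *v chart_differential d w p)"
    by (simp add: chart_energy_def chart_differential_transform[OF w c d])
  also have "\<dots> = (?J *v (T c p *v gradient g z c p)) \<bullet> chart_differential d w p"
    by (simp add: dot_lmul_matrix[symmetric] inner_commute transpose_matrix_vector)
  also have "\<dots> = chart_energy g T d z w p"
    by (simp add: chart_energy_def gradient_transform[OF z c d] matrix_vector_mul_assoc TJ)
  finally show ?thesis .
qed

lemma chart_energy_sym:
  assumes "c \<in> A" "p \<in> chart_dom c"
  shows "chart_energy g T c z w p = chart_energy g T c w z p"
proof -
  have "chart_energy g T c z w p = (T c p *v gradient g z c p) \<bullet> (g c p *v gradient g w c p)"
    by (simp add: chart_energy_def metric_gradient[OF assms])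
  also have "\<dots> = gradient g z c p \<bullet> (g c p *v (T c p *v gradient g w c p))"
    using tensor_sym assms unfolding symmetric_tensor11_def by blast
  also have "\<dots> = (transpose (g c p) *v gradient g z c p) \<bullet> (T c p *v gradient g w c p)"
    by (simp add: dot_lmul_matrix transpose_matrix_vector)
  also have "\<dots> = chart_energy g T c w z p"
    by (simp add: metric_symmetric[OF assms] metric_gradient[OF assms] chart_energy_def inner_commute)
  finally show ?thesis .
qed

definition energy :: "('m \<Rightarrow> real) \<Rightarrow> ('m \<Rightarrow> real) \<Rightarrow> 'm \<Rightarrow> real" where
  "energy z w = metric_inner A g (apply_tensor T (gradient g z)) (gradient g w)"

lemma energy_chart:
  assumes "Ck_fun A (Suc k) z" "Ck_fun A (Suc k) w" "c \<in> A" "p \<in> chart_dom c"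
  shows "energy z w p = chart_energy g T c z w p"
proof -
  have "energy z w p = chart_energy g T (chart_at A p) z w p"
    by (simp add: energy_def metric_inner_def apply_tensor_def chart_energy_def Let_def
        metric_gradient[OF chart_at])
  then show ?thesis using chart_energy_indep[OF assms(1,2) chart_at assms(3,4)] by simp
qed

lemma energy_sym:
  assumes "Ck_fun A (Suc k) z" "Ck_fun A (Suc k) w"
  shows "energy z w p = energy w z p"
  using energy_chart[OF assms chart_at] energy_chart[OF assms(2,1) chart_at] chart_energy_sym[OF chart_at]
  by simp

section \<open>The weighted measure in a chart\<close>

definition \<mu> :: "'m measure" where "\<mu> = weighted_measure \<nu> f"

definition chart_density :: "('m, 'n) chart \<Rightarrow> 'm \<Rightarrow> real" where
  "chart_density c p = volume_density g c p * exp (- f p)"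

lemma sets_\<nu>: "sets \<nu> = sets borel" and space_\<nu>: "space \<nu> = UNIV"
  using volume unfolding riemannian_volume_def by (auto dest: sets_eq_imp_space_eq)

lemma sets_\<mu>: "sets \<mu> = sets borel" and space_\<mu>: "space \<mu> = UNIV"
  by (simp_all add: \<mu>_def weighted_measure_def sets_\<nu> space_\<nu>)

lemma continuous_f: "continuous_on UNIV f"
  by (rule Ck_fun_continuous[OF smooth_fun_Ck[OF potential]])

lemma f_measurable: "f \<in> borel_measurable \<nu>"
  using borel_measurable_continuous_onI[OF continuous_f] sets_\<nu> by (simp cong: measurable_cong_sets)

lemma volume_density_pos: "c \<in> A \<Longrightarrow> p \<in> chart_dom c \<Longrightarrow> volume_density g c p > 0"
  by (simp add: volume_density_def metric_det_pos)

lemma chart_density_pos: "c \<in> A \<Longrightarrow> p \<in> chart_dom c \<Longrightarrow> chart_density c p > 0"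
  by (simp add: chart_density_def volume_density_pos)

lemma smooth_imp_C1: "c \<in> A \<Longrightarrow> smooth_on (chart_img c) F \<Longrightarrow> C1_on (chart_img c) F"
  unfolding C1_on_iff_Ck_on by (rule smooth_on_imp_Ck_on[OF open_img])

lemma metric_C1:
  assumes "c \<in> A" shows "C1_on (chart_img c) (\<lambda>x. g c (chart_inv c x) $ i $ j)"
proof -
  have "smooth_on (chart_img c) (\<lambda>x. g c (chart_inv c x))"
    using metric assms unfolding riemannian_metric_def by blast
  from smooth_imp_C1[OF assms this] show ?thesis by (intro C1_on_component open_img assms)
qed

lemma tensor_C1:
  assumes "c \<in> A" shows "C1_on (chart_img c) (\<lambda>x. T c (chart_inv c x) $ i $ j)"
proof -
  have "smooth_on (chart_img c) (\<lambda>x. T c (chart_inv c x))"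
    using tensor assms unfolding smooth_tensor11_def by blast
  from smooth_imp_C1[OF assms this] show ?thesis by (intro C1_on_component open_img assms)
qed

lemma volume_density_C1:
  assumes "c \<in> A" shows "C1_on (chart_img c) (\<lambda>x. volume_density g c (chart_inv c x))"
  unfolding volume_density_def
  by (intro C1_on_sqrt C1_on_det metric_C1 metric_det_pos assms inv_in_dom)

lemma chart_density_C1:
  assumes "c \<in> A" shows "C1_on (chart_img c) (\<lambda>x. chart_density c (chart_inv c x))"
  unfolding chart_density_def
proof (intro C1_on_mult C1_on_exp volume_density_C1 assms)
  have f: "C1_on (chart_img c) (\<lambda>x. f (chart_inv c x))"
    using smooth_fun_Ck[OF potential, of "Suc 0"] assms unfolding C1_fun_iff by blast
  have "C1_on (chart_img c) (\<lambda>x. (-1) * f (chart_inv c x))" by (intro C1_on_mult C1_on_const f)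
  then show "C1_on (chart_img c) (\<lambda>x. - f (chart_inv c x))" by simp
qed

text \<open>
  The Riemannian volume is given by its values on Borel subsets of charts. As an equality of measures
  on the whole space this allows integrals to be pulled back to coordinates. The value \<open>undefined\<close>
  off the image of the chart is harmless, since the density vanishes there.
\<close>

lemma restrict_volume:
  assumes c: "c \<in> A"
  shows "density \<nu> (\<lambda>p. ennreal (indicator (chart_dom c) p)) =
    distr (density lborel (\<lambda>x. ennreal (if x \<in> chart_img c then volume_density g c (chart_inv c x) else 0)))
      borel (\<lambda>x. if x \<in> chart_img c then chart_inv c x else undefined)"
    (is "?N = distr ?D borel ?\<kappa>")
proof (rule measure_eqI)
  show "sets ?N = sets (distr ?D borel ?\<kappa>)" by (simp add: sets_\<nu>)
  fix B assume "B \<in> sets ?N"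
  then have B: "B \<in> sets borel" by (simp add: sets_\<nu>)
  have dom: "chart_dom c \<in> sets borel" using open_dom[OF c] by simp
  have [measurable]: "?\<kappa> \<in> borel_measurable borel"
    by (rule measurable_if_open[OF open_img[OF c] continuous_inv[OF c]])
  have vm: "(\<lambda>x. if x \<in> chart_img c then volume_density g c (chart_inv c x) else 0) \<in> borel_measurable borel"
    by (rule measurable_if_open[OF open_img[OF c] C1_on_continuous[OF volume_density_C1[OF c]]])
  have "emeasure ?N B = (\<integral>\<^sup>+p. ennreal (indicator (chart_dom c) p) * indicator B p \<partial>\<nu>)"
    using dom B by (subst emeasure_density) (auto simp: sets_\<nu> cong: measurable_cong_sets)
  also have "\<dots> = (\<integral>\<^sup>+p. indicator (B \<inter> chart_dom c) p \<partial>\<nu>)"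
    by (intro nn_integral_cong) (auto simp: indicator_def)
  also have "\<dots> = emeasure \<nu> (B \<inter> chart_dom c)"
    using dom B by (simp add: sets_\<nu>)
  also have "\<dots> = (\<integral>\<^sup>+x\<in>chart_map c ` (B \<inter> chart_dom c). ennreal (volume_density g c (chart_inv c x)) \<partial>lborel)"
    using volume c dom B unfolding riemannian_volume_def by auto
  also have "chart_map c ` (B \<inter> chart_dom c) = chart_img c \<inter> chart_inv c -` B"
    using image_chart[OF c, of B] by (simp add: Int_commute)
  also have "(\<integral>\<^sup>+x\<in>chart_img c \<inter> chart_inv c -` B. ennreal (volume_density g c (chart_inv c x)) \<partial>lborel)
    = (\<integral>\<^sup>+x. ennreal (if x \<in> chart_img c then volume_density g c (chart_inv c x) else 0)
         * indicator (?\<kappa> -` B) x \<partial>lborel)"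
    by (intro nn_integral_cong) (auto simp: indicator_def)
  also have "\<dots> = emeasure ?D (?\<kappa> -` B)"
    using vm measurable_sets[of ?\<kappa> borel borel B] B by (subst emeasure_density) auto
  also have "\<dots> = emeasure (distr ?D borel ?\<kappa>) B"
    using B by (subst emeasure_distr) auto
  finally show "emeasure ?N B = emeasure (distr ?D borel ?\<kappa>) B" .
qed

lemma integral_\<mu>:
  fixes h :: "'m \<Rightarrow> real"
  assumes "h \<in> borel_measurable borel"
  shows "(\<integral>p. h p \<partial>\<mu>) = (\<integral>p. exp (- f p) * h p \<partial>\<nu>)"
  unfolding \<mu>_def weighted_measure_def
  using assms f_measurable by (subst integral_density) (auto simp: sets_\<nu> cong: measurable_cong_sets)

lemma integral_in_chart:
  fixes h :: "'m \<Rightarrow> real"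
  assumes c: "c \<in> A" and h: "h \<in> borel_measurable borel" and supp: "\<And>p. p \<notin> chart_dom c \<Longrightarrow> h p = 0"
  shows "(\<integral>p. h p \<partial>\<mu>) =
    (\<integral>x. (if x \<in> chart_img c then chart_density c (chart_inv c x) * h (chart_inv c x) else 0) \<partial>lborel)"
proof -
  let ?\<kappa> = "\<lambda>x. if x \<in> chart_img c then chart_inv c x else undefined"
  let ?v = "\<lambda>x. if x \<in> chart_img c then volume_density g c (chart_inv c x) else 0"
  let ?h = "\<lambda>p. exp (- f p) * h p"
  have dom: "chart_dom c \<in> sets borel" using open_dom[OF c] by simp
  have hm: "?h \<in> borel_measurable borel"
    using h borel_measurable_continuous_onI[OF continuous_f] by measurable
  have \<kappa>m: "?\<kappa> \<in> borel_measurable borel"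
    by (rule measurable_if_open[OF open_img[OF c] continuous_inv[OF c]])
  have vm: "?v \<in> borel_measurable borel"
    by (rule measurable_if_open[OF open_img[OF c] C1_on_continuous[OF volume_density_C1[OF c]]])
  have "(\<integral>p. h p \<partial>\<mu>) = (\<integral>p. ?h p \<partial>\<nu>)" by (rule integral_\<mu>[OF h])
  also have "\<dots> = (\<integral>p. indicator (chart_dom c) p *\<^sub>R ?h p \<partial>\<nu>)"
    by (intro Bochner_Integration.integral_cong) (auto simp: indicator_def supp)
  also have "\<dots> = (\<integral>p. ?h p \<partial>density \<nu> (\<lambda>p. ennreal (indicator (chart_dom c) p)))"
    using hm dom by (subst integral_density) (auto simp: sets_\<nu> cong: measurable_cong_sets)
  also have "\<dots> = (\<integral>x. ?h (?\<kappa> x) \<partial>density lborel (\<lambda>x. ennreal (?v x)))"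
    unfolding restrict_volume[OF c] by (rule integral_distr) (use hm \<kappa>m in auto)
  also have "\<dots> = (\<integral>x. ?v x *\<^sub>R ?h (?\<kappa> x) \<partial>lborel)"
  proof (rule integral_density)
    show "(\<lambda>x. ?h (?\<kappa> x)) \<in> borel_measurable lborel"
      using measurable_compose[OF \<kappa>m hm] by simp
    show "?v \<in> borel_measurable lborel" using vm by simp
    show "AE x in lborel. 0 \<le> ?v x"
      using volume_density_pos[OF c inv_in_dom[OF c]] by (auto intro!: AE_I2 less_imp_le)
  qed
  also have "\<dots> = (\<integral>x. (if x \<in> chart_img c then chart_density c (chart_inv c x) * h (chart_inv c x) else 0) \<partial>lborel)"
    by (intro Bochner_Integration.integral_cong) (auto simp: chart_density_def)
  finally show ?thesis .
qed

lemma emeasure_compact_chart_finite: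
  assumes c: "c \<in> A" and K: "compact K" "K \<subseteq> chart_dom c"
  shows "emeasure \<nu> K < \<infinity>"
proof -
  let ?v = "\<lambda>x. volume_density g c (chart_inv c x)"
  have cK: "compact (chart_map c ` K)"
    by (rule compact_continuous_image[OF continuous_on_subset[OF continuous_map[OF c] K(2)] K(1)])
  have sub: "chart_map c ` K \<subseteq> chart_img c" using K map_in_img[OF c] by auto
  have "compact (?v ` (chart_map c ` K))"
    by (rule compact_continuous_image[OF continuous_on_subset[OF C1_on_continuous[OF volume_density_C1[OF c]] sub] cK])
  then obtain B where B: "\<And>x. x \<in> chart_map c ` K \<Longrightarrow> \<bar>?v x\<bar> \<le> B"
    by (drule_tac compact_imp_bounded) (auto simp: bounded_iff)
  have "emeasure \<nu> K = (\<integral>\<^sup>+x\<in>chart_map c ` K. ennreal (?v x) \<partial>lborel)"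
    using volume c K compact_imp_closed[OF K(1)] unfolding riemannian_volume_def by auto
  also have "\<dots> \<le> (\<integral>\<^sup>+x. ennreal B * indicator (chart_map c ` K) x \<partial>lborel)"
    using B by (intro nn_integral_mono) (force simp: indicator_def intro!: ennreal_leI)
  also have "\<dots> = ennreal B * emeasure lborel (chart_map c ` K)"
    using cK by (subst nn_integral_cmult_indicator) (auto intro: borel_compact)
  also have "\<dots> < \<infinity>"
    using emeasure_compact_finite[OF cK] by (auto simp: ennreal_mult_less_top)
  finally show ?thesis .
qed

section \<open>Cut-off functions\<close>

text \<open>
  The coordinate expression of a small ball bump is extended by zero. In another chart the result is
  \<open>C\<^sup>1\<close> because its domain is covered by two open sets: on one a transition map is available, and
  on the other, the complement of the compact support, the function vanishes.
\<close>

lemma bump_exists: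
  assumes c: "c \<in> A" "p \<in> chart_dom c" and U: "open U" "p \<in> U"
  obtains \<eta> K where "Ck_fun A (Suc 0) \<eta>" "\<And>q. \<eta> q \<ge> 0" "\<eta> p > 0" "compact K"
    "K \<subseteq> chart_dom c \<inter> U" "\<And>q. q \<notin> K \<Longrightarrow> \<eta> q = 0"
proof -
  let ?V = "chart_map c ` (chart_dom c \<inter> U)" and ?x0 = "chart_map c p"
  have "open ?V" "?x0 \<in> ?V" using open_image_chart[OF c(1) U(1)] c U by auto
  then obtain r where r: "r > 0" "cball ?x0 r \<subseteq> ?V" using open_contains_cball by blast
  define b where "b x = (max 0 (r\<^sup>2 - (x - ?x0) \<bullet> (x - ?x0)))\<^sup>2" for x
  define \<eta> where "\<eta> q = (if q \<in> chart_dom c then b (chart_map c q) else 0)" for q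
  define K where "K = chart_inv c ` cball ?x0 r"
  have Vi: "?V \<subseteq> chart_img c" using map_in_img[OF c(1)] by auto
  have K: "compact K" unfolding K_def
    by (rule compact_continuous_image[OF continuous_on_subset[OF continuous_inv[OF c(1)]]])
      (use r Vi in auto)
  have Ksub: "K \<subseteq> chart_dom c \<inter> U" using r(2) inv_map[OF c(1)] unfolding K_def by fastforce
  have b0: "b x = 0" if "x \<notin> cball ?x0 r" for x
  proof -
    have "r\<^sup>2 \<le> (norm (x - ?x0))\<^sup>2"
      using that r(1) by (intro power_mono) (auto simp: dist_norm norm_minus_commute)
    then show ?thesis by (simp add: b_def power2_norm_eq_inner)
  qed
  have \<eta>0: "\<eta> q = 0" if "q \<notin> K" for q
  proof (cases "q \<in> chart_dom c")
    case True
    then have "chart_map c q \<notin> cball ?x0 r"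
      using that inv_map[OF c(1) True] unfolding K_def by (metis imageI)
    then show ?thesis by (simp add: \<eta>_def b0)
  qed (simp add: \<eta>_def)
  have "C1_on (chart_img d) (\<lambda>x. \<eta> (chart_inv d x))" if d: "d \<in> A" for d
    unfolding C1_on_iff_Ck_on
  proof (rule Ck_on_local)
    fix x assume x: "x \<in> chart_img d"
    let ?W1 = "chart_map d ` (chart_dom d \<inter> chart_dom c)" and ?W2 = "chart_map d ` (chart_dom d \<inter> - K)"
    have o: "open ?W1" "open ?W2"
      using open_image_chart[OF d] open_dom[OF c(1)] compact_imp_closed[OF K] by auto
    have "C1_on ?W1 (\<lambda>x. b (chart_map c (chart_inv d x)))"
      using transition_Ck[OF d c(1), of "Suc 0"] unfolding C1_on_iff_Ck_on[symmetric]
      by (rule C1_on_compose[where F = b and R = UNIV, rotated]) (auto simp: b_def[abs_def] intro: bump_C1)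
    then have "C1_on ?W1 (\<lambda>x. \<eta> (chart_inv d x))"
      by (rule C1_on_cong[OF o(1), rotated]) (use inv_map[OF d] in \<open>auto simp: \<eta>_def\<close>)
    moreover have "C1_on ?W2 (\<lambda>x. \<eta> (chart_inv d x))"
      by (rule C1_on_cong[OF o(2) _ C1_on_const[of _ 0]]) (use inv_map[OF d] in \<open>auto simp: \<eta>0\<close>)
    moreover have "x \<in> ?W1 \<or> x \<in> ?W2" using x Ksub unfolding image_chart[OF d] by auto
    ultimately show "\<exists>W. open W \<and> x \<in> W \<and> Ck_on (Suc 0) W (\<lambda>x. \<eta> (chart_inv d x))"
      using o unfolding C1_on_iff_Ck_on by blast
  qed
  then have "Ck_fun A (Suc 0) \<eta>" by (simp add: C1_fun_iff)
  moreover have "\<eta> p > 0" using c r by (simp add: \<eta>_def b_def)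
  moreover have "\<eta> q \<ge> 0" for q by (simp add: \<eta>_def b_def)
  ultimately show thesis using that K Ksub \<eta>0 by blast
qed

text \<open>
  Division by the positive sum of the \<open>\<eta> i\<close> turns this family into a partition of unity. The compact
  sets also cover the manifold, which shows that it has finite volume.
\<close>

lemma finite_bumps:
  obtains P :: "'m set" and c \<eta> K where "finite P"
    "\<And>i. i \<in> P \<Longrightarrow> c i \<in> A" "\<And>i. i \<in> P \<Longrightarrow> Ck_fun A (Suc 0) (\<eta> i)" "\<And>i. i \<in> P \<Longrightarrow> compact (K i)"
    "\<And>i. i \<in> P \<Longrightarrow> K i \<subseteq> chart_dom (c i)" "\<And>i q. i \<in> P \<Longrightarrow> q \<notin> K i \<Longrightarrow> \<eta> i q = 0"
    "\<And>q. (\<Sum>i\<in>P. \<eta> i q) > 0" "(\<Union>i\<in>P. K i) = UNIV"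
proof -
  have "\<exists>c \<eta> K. c \<in> A \<and> Ck_fun A (Suc 0) \<eta> \<and> (\<forall>q. \<eta> q \<ge> 0) \<and> \<eta> p > 0 \<and> compact K \<and>
      K \<subseteq> chart_dom c \<and> (\<forall>q. q \<notin> K \<longrightarrow> \<eta> q = 0)" for p
  proof -
    obtain c where c: "c \<in> A" "p \<in> chart_dom c" by (rule chart_cover)
    show ?thesis by (rule bump_exists[OF c open_UNIV UNIV_I], intro exI[of _ c]) (use c in blast)
  qed
  then obtain c \<eta> K where *: "\<And>p. c p \<in> A" "\<And>p. Ck_fun A (Suc 0) (\<eta> p)" "\<And>p q. \<eta> p q \<ge> 0"
    "\<And>p. \<eta> p p > 0" "\<And>p. compact (K p)" "\<And>p. K p \<subseteq> chart_dom (c p)" "\<And>p q. q \<notin> K p \<Longrightarrow> \<eta> p q = 0"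
    by metis
  have "open {q. \<eta> p q > 0}" for p
    using Ck_fun_continuous[OF *(2)] by (intro open_Collect_less continuous_on_const)
  moreover have "UNIV \<subseteq> (\<Union>p\<in>UNIV. {q. \<eta> p q > 0})" using *(4) by auto
  ultimately obtain P where P: "finite P" "UNIV \<subseteq> (\<Union>p\<in>P. {q. \<eta> p q > 0})"
    using compactE_image[OF compact_space, of UNIV "\<lambda>p. {q. \<eta> p q > 0}"] by metis
  show thesis
  proof (rule that[of P c \<eta> K])
    show "(\<Sum>i\<in>P. \<eta> i q) > 0" for q
    proof -
      obtain i where "i \<in> P" "\<eta> i q > 0" using P(2) by blast
      then show ?thesis using P(1) *(3) by (metis sum_pos2)
    qed
    have "\<exists>i\<in>P. q \<in> K i" for q
    proof -
      obtain i where i: "i \<in> P" "\<eta> i q > 0" using P(2) by blast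
      then show ?thesis using *(7)[of q i] by fastforce
    qed
    then show "(\<Union>i\<in>P. K i) = UNIV" by auto
  qed (use P * in auto)
qed

lemma finite_\<mu>: "finite_measure \<mu>"
proof -
  obtain P :: "'m set" and c \<eta> K where P: "finite P"
    "\<And>i. i \<in> P \<Longrightarrow> c i \<in> A" "\<And>i. i \<in> P \<Longrightarrow> compact (K i)"
    "\<And>i. i \<in> P \<Longrightarrow> K i \<subseteq> chart_dom (c i)" "(\<Union>i\<in>P. K i) = UNIV"
    by (rule finite_bumps) blast
  have "emeasure \<nu> (\<Union>i\<in>P. K i) \<le> (\<Sum>i\<in>P. emeasure \<nu> (K i))"
    using P(1,3) borel_closed[OF compact_imp_closed]
    by (intro emeasure_subadditive_finite) (auto simp: sets_\<nu>)
  also have "\<dots> < \<infinity>" using emeasure_compact_chart_finite[OF P(2-4)] P(1) by auto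
  finally have \<nu>: "emeasure \<nu> UNIV < \<infinity>" by (simp add: P)
  have "bounded (f ` UNIV)"
    by (intro compact_imp_bounded compact_continuous_image compact_space continuous_f)
  then obtain B where B: "\<And>p. \<bar>f p\<bar> \<le> B" by (auto simp: bounded_iff)
  have "emeasure \<mu> UNIV = (\<integral>\<^sup>+p. ennreal (exp (- f p)) \<partial>\<nu>)"
    unfolding \<mu>_def weighted_measure_def using f_measurable
    by (subst emeasure_density) (auto simp: space_\<nu>[symmetric])
  also have "\<dots> \<le> (\<integral>\<^sup>+p. ennreal (exp B) \<partial>\<nu>)"
    using B by (intro nn_integral_mono ennreal_leI) (simp add: abs_le_iff)
  also have "\<dots> < \<infinity>" using \<nu> by (simp add: space_\<nu> ennreal_mult_less_top)
  finally show ?thesis by (intro finite_measureI) (simp add: space_\<mu>)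
qed

lemma continuous_integrable:
  fixes h :: "'m \<Rightarrow> real"
  assumes "continuous_on UNIV h"
  shows "integrable \<mu> h"
proof -
  interpret finite_measure \<mu> by (rule finite_\<mu>)
  have "bounded (h ` UNIV)" by (intro compact_imp_bounded compact_continuous_image compact_space assms)
  then obtain B where "\<And>p. \<bar>h p\<bar> \<le> B" by (auto simp: bounded_iff)
  then show ?thesis
    using borel_measurable_continuous_onI[OF assms] sets_\<mu>
    by (intro integrable_const_bound[of _ B]) (auto cong: measurable_cong_sets)
qed

text \<open>
  A nonempty open set in a chart has positive volume.
\<close>

lemma integral_pos:
  fixes h :: "'m \<Rightarrow> real"
  assumes cont: "continuous_on UNIV h" and nonneg: "\<And>q. h q \<ge> 0" and p: "h p > 0"
  shows "(\<integral>q. h q \<partial>\<mu>) > 0"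
proof (rule ccontr)
  assume "\<not> ?thesis"
  moreover have "(\<integral>q. h q \<partial>\<mu>) \<ge> 0" using nonneg by simp
  ultimately have "(\<integral>q. h q \<partial>\<mu>) = 0" by simp
  then have "AE q in \<mu>. h q = 0"
    using integral_nonneg_eq_0_iff_AE[OF continuous_integrable[OF cont]] nonneg by simp
  then have AE: "AE q in \<nu>. h q = 0"
    unfolding \<mu>_def weighted_measure_def using f_measurable by (subst (asm) AE_density) auto
  obtain c where c: "c \<in> A" "p \<in> chart_dom c" by (rule chart_cover)
  let ?V = "chart_map c ` (chart_dom c \<inter> {q. h q > 0})"
  have oh: "open {q. h q > 0}" using cont by (intro open_Collect_less continuous_on_const)
  have oV: "open ?V" by (rule open_image_chart[OF c(1) oh])
  let ?U = "chart_dom c \<inter> {q. h q > 0}"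
  have "open ?U" using oh open_dom[OF c(1)] by auto
  have "emeasure \<nu> ?U = 0"
  proof -
    have "AE q in \<nu>. q \<notin> ?U" using AE by (rule AE_mp) (auto intro!: AE_I2)
    then show ?thesis using \<open>open ?U\<close> by (subst (asm) AE_iff_measurable) (auto simp: sets_\<nu> space_\<nu>)
  qed
  then have "(\<integral>\<^sup>+x\<in>?V. ennreal (volume_density g c (chart_inv c x)) \<partial>lborel) = 0"
    using volume c \<open>open ?U\<close> unfolding riemannian_volume_def by auto
  moreover have "(\<lambda>x. ennreal (volume_density g c (chart_inv c x)) * indicator ?V x) \<in> borel_measurable lborel"
  proof -
    have "(\<lambda>x. ennreal (if x \<in> ?V then volume_density g c (chart_inv c x) else 0)) \<in> borel_measurable borel"
      by (intro measurable_compose[OF _ measurable_ennreal] measurable_if_open oV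
          continuous_on_subset[OF C1_on_continuous[OF volume_density_C1[OF c(1)]]]) (auto simp: map_in_img c)
    also have "(\<lambda>x. ennreal (if x \<in> ?V then volume_density g c (chart_inv c x) else 0)) =
      (\<lambda>x. ennreal (volume_density g c (chart_inv c x)) * indicator ?V x)" by (auto simp: indicator_def)
    finally show ?thesis by simp
  qed
  ultimately have "AE x in lborel. ennreal (volume_density g c (chart_inv c x)) * indicator ?V x = 0"
    by (simp add: nn_integral_0_iff_AE)
  then have "AE x in lborel. x \<notin> ?V"
  proof (rule AE_mp, intro AE_I2 impI notI)
    fix x assume 0: "ennreal (volume_density g c (chart_inv c x)) * indicator ?V x = 0" and x: "x \<in> ?V"
    have "volume_density g c (chart_inv c x) > 0" using x inv_map[OF c(1)] volume_density_pos[OF c(1)] by auto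
    then show False using 0 x by simp
  qed
  then have "emeasure lborel ?V = 0" using oV by (subst (asm) AE_iff_measurable) auto
  moreover have "negligible ?V \<longleftrightarrow> emeasure lborel ?V = 0"
    using oV by (simp add: negligible_iff_null_sets null_sets_completion_iff null_sets_def)
  ultimately show False using open_not_negligible[OF oV] c p by auto
qed

section \<open>Green's formula\<close>

text \<open>
  The components \<open>Y\<^sub>i\<close> of \<open>e\<^sup>-\<^sup>f T (\<nabla> z)\<close> times \<open>\<surd>|g|\<close>, as functions of the coordinates. Their
  partial derivatives \<open>\<partial>\<^sub>i Y\<^sub>i\<close> add up to \<open>e\<^sup>-\<^sup>f \<surd>|g| L z\<close>.
\<close>

definition weighted_flux :: "('m, 'n) chart \<Rightarrow> ('m \<Rightarrow> real) \<Rightarrow> 'n \<Rightarrow> real ^ 'n \<Rightarrow> real" where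
  "weighted_flux c z i x = volume_density g c (chart_inv c x) *
     (exp (- f (chart_inv c x)) *\<^sub>R apply_tensor T (gradient g z) c (chart_inv c x)) $ i"

text \<open>
  The coordinate formula for \<open>L z\<close> in a prescribed chart, in contrast to \<^const>\<open>L_op\<close>, which selects
  one at each point.
\<close>

definition chart_op :: "('m, 'n) chart \<Rightarrow> ('m \<Rightarrow> real) \<Rightarrow> 'm \<Rightarrow> real" where
  "chart_op c z p = exp (f p) *
     ((\<Sum>i\<in>UNIV. partial_deriv (weighted_flux c z i) i (chart_map c p)) / volume_density g c p)"

lemma L_op_chart_at: "L_op A g T f z p = chart_op (chart_at A p) z p"
  by (simp add: L_op_def weighted_divergence_def divergence_def chart_op_def weighted_flux_def[abs_def] Let_def)

lemma weighted_flux_eq: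
  "weighted_flux c z i x = chart_density c (chart_inv c x) * (T c (chart_inv c x) *v gradient g z c (chart_inv c x)) $ i"
  by (simp add: weighted_flux_def chart_density_def apply_tensor_def)

lemma C1_fun_Suc: "Ck_fun A (Suc k) h \<Longrightarrow> Ck_fun A (Suc 0) h"
  by (induction k) (auto simp: Ck_fun_def dest: Ck_on_Suc_imp)

lemma chart_differential_Ck:
  assumes "Ck_fun A (Suc k) h" "c \<in> A"
  shows "Ck_on k (chart_img c) (\<lambda>x. chart_differential c h (chart_inv c x) $ i)"
proof (rule Ck_on_cong[OF open_img[OF assms(2)]])
  show "Ck_on k (chart_img c) (\<lambda>x. frechet_derivative (\<lambda>x. h (chart_inv c x)) (at x) (axis i 1))"
    using assms by (simp add: Ck_fun_def Ck_on.simps)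
qed (simp add: chart_differential_def partial_deriv_def map_inv[OF assms(2)])

lemma weighted_flux_C1:
  assumes z: "Ck_fun A (Suc (Suc 0)) z" and c: "c \<in> A"
  shows "C1_on (chart_img c) (weighted_flux c z i)"
proof -
  let ?d = "\<lambda>x. chart_differential c z (chart_inv c x)"
  have "C1_on (chart_img c) (\<lambda>x. ?d x $ j)" for j
    unfolding C1_on_iff_Ck_on by (rule chart_differential_Ck[OF z c])
  then have G: "C1_on (chart_img c) (\<lambda>x. (matrix_inv (g c (chart_inv c x)) *v ?d x) $ j)" for j
    using metric_det_pos[OF c inv_in_dom[OF c]]
    by (intro C1_on_matrix_inv_mult open_img c metric_C1) (auto simp: less_imp_neq[symmetric])
  have "C1_on (chart_img c) (\<lambda>x. chart_density c (chart_inv c x) *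
      (\<Sum>j\<in>UNIV. T c (chart_inv c x) $ i $ j * (matrix_inv (g c (chart_inv c x)) *v ?d x) $ j))"
    by (intro C1_on_mult C1_on_sum chart_density_C1 tensor_C1 G c)
  also have "(\<lambda>x. chart_density c (chart_inv c x) *
      (\<Sum>j\<in>UNIV. T c (chart_inv c x) $ i $ j * (matrix_inv (g c (chart_inv c x)) *v ?d x) $ j))
    = weighted_flux c z i"
    by (simp add: fun_eq_iff weighted_flux_eq gradient_eq matrix_vector_mult_def[of "T c _"])
  finally show ?thesis .
qed

lemma chart_op_continuous:
  assumes z: "Ck_fun A (Suc (Suc 0)) z" and c: "c \<in> A"
  shows "continuous_on (chart_dom c) (chart_op c z)"
proof -
  have "continuous_on (chart_dom c) (\<lambda>p. partial_deriv (weighted_flux c z i) i (chart_map c p))" for i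
    using C1_on_partial_continuous[OF weighted_flux_C1[OF z c]] map_in_img[OF c]
    by (intro continuous_on_compose2[OF _ continuous_map[OF c]]) auto
  moreover have "continuous_on (chart_dom c) (volume_density g c)"
    by (rule continuous_on_dom[OF c C1_on_continuous[OF volume_density_C1[OF c]]])
  moreover have "volume_density g c p \<noteq> 0" if "p \<in> chart_dom c" for p
    using volume_density_pos[OF c that] by simp
  ultimately show ?thesis unfolding chart_op_def
    by (intro continuous_intros continuous_on_subset[OF continuous_f]) auto
qed

lemma energy_continuous:
  assumes z: "Ck_fun A (Suc (Suc 0)) z" and w: "Ck_fun A (Suc 0) w"
  shows "continuous_on UNIV (energy z w)"
proof (rule continuous_on_manifold, rule continuous_on_dom)
  fix c assume c: "c \<in> A"
  have "continuous_on (chart_img c) (\<lambda>x. \<Sum>i\<in>UNIV.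
      weighted_flux c z i x / chart_density c (chart_inv c x) * chart_differential c w (chart_inv c x) $ i)"
    using chart_differential_Ck[OF w c] chart_density_pos[OF c inv_in_dom[OF c]]
    by (intro continuous_on_sum continuous_on_mult continuous_on_divide
        C1_on_continuous[OF weighted_flux_C1[OF z c]] C1_on_continuous[OF chart_density_C1[OF c]])
      (auto simp: Ck_on.simps less_imp_neq[symmetric])
  then show "continuous_on (chart_img c) (\<lambda>x. energy z w (chart_inv c x))"
  proof (rule continuous_on_eq)
    fix x assume "x \<in> chart_img c"
    then have p: "chart_inv c x \<in> chart_dom c" by (rule inv_in_dom[OF c])
    show "(\<Sum>i\<in>UNIV. weighted_flux c z i x / chart_density c (chart_inv c x)
        * chart_differential c w (chart_inv c x) $ i) = energy z w (chart_inv c x)"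
      using chart_density_pos[OF c p]
      by (simp add: energy_chart[OF C1_fun_Suc[OF z] w c p] chart_energy_def inner_vec_def weighted_flux_eq)
  qed
qed

lemma energy_zero:
  assumes z: "Ck_fun A (Suc k) z" and w: "Ck_fun A (Suc 0) w" and U: "open U" "p \<in> U" "\<And>q. q \<in> U \<Longrightarrow> w q = 0"
  shows "energy z w p = 0"
proof -
  obtain c where c: "c \<in> A" "p \<in> chart_dom c" by (rule chart_cover)
  have "((\<lambda>x. w (chart_inv c x)) has_derivative (\<lambda>v. v \<bullet> 0)) (at (chart_map c p))"
    by (rule has_derivative_transform_within_open[of "\<lambda>x. 0", OF _ open_image_chart[OF c(1) U(1)]])
      (use c U inv_map[OF c(1)] in auto)
  then have "chart_differential c w p = 0" by (rule chart_differential_eqI)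
  then show ?thesis using energy_chart[OF C1_fun_Suc[OF z] w c] by (simp add: chart_energy_def)
qed

lemma continuous_extend_zero:
  assumes "c \<in> A" "continuous_on (chart_dom c) h" "compact K" "K \<subseteq> chart_dom c" "\<And>q. q \<notin> K \<Longrightarrow> h q = 0"
  shows "continuous_on UNIV (h :: 'm \<Rightarrow> real)"
proof -
  have "continuous_on (- K) h"
    by (rule continuous_on_eq[of _ "\<lambda>_. 0"]) (auto simp: assms)
  then have "continuous_on (chart_dom c \<union> - K) h"
    using assms open_dom by (intro continuous_on_open_Un) (auto intro: compact_imp_closed)
  moreover have "chart_dom c \<union> - K = UNIV" using assms by auto
  ultimately show ?thesis by simp
qed

text \<open>
  In coordinates the weighted measure has the density \<open>\<rho> = e\<^sup>-\<^sup>f \<surd>|g|\<close>, and with the fluxes \<open>Y\<^sub>i\<close> the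
  product rule gives \<open>\<rho> (w L z + T (\<nabla> z, \<nabla> w)) = \<Sum>\<^sub>i \<partial>\<^sub>i (w Y\<^sub>i)\<close>, whose integral vanishes.
\<close>

lemma green_in_chart:
  assumes z: "Ck_fun A (Suc (Suc 0)) z" and w: "Ck_fun A (Suc 0) w" and c: "c \<in> A"
    and K: "compact K" "K \<subseteq> chart_dom c" "\<And>q. q \<notin> K \<Longrightarrow> w q = 0"
  shows "continuous_on UNIV (\<lambda>p. w p * chart_op c z p)"
    and "(\<integral>p. w p * chart_op c z p \<partial>\<mu>) = - (\<integral>p. energy z w p \<partial>\<mu>)"
proof -
  show c1: "continuous_on UNIV (\<lambda>p. w p * chart_op c z p)"
    using Ck_fun_continuous[OF w]
    by (intro continuous_extend_zero[OF c _ K(1,2)] continuous_intros chart_op_continuous z c)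
      (auto simp: K intro: continuous_on_subset)
  have c2: "continuous_on UNIV (energy z w)" by (rule energy_continuous[OF z w])
  have e0: "energy z w q = 0" if "q \<notin> K" for q
    by (rule energy_zero[OF z w, of "- K"]) (use K that in \<open>auto intro: compact_imp_closed\<close>)
  let ?w = "\<lambda>x. w (chart_inv c x)" and ?Y = "weighted_flux c z" and ?K = "chart_map c ` K"
  let ?F = "\<lambda>i x. ?w x * ?Y i x"
  let ?h = "\<lambda>p. w p * chart_op c z p + energy z w p"
  have w1: "C1_on (chart_img c) ?w" using w c unfolding C1_fun_iff by blast
  have Y1: "C1_on (chart_img c) (?Y i)" for i by (rule weighted_flux_C1[OF z c])
  have cK: "compact ?K"
    by (rule compact_continuous_image[OF continuous_on_subset[OF continuous_map[OF c] K(2)] K(1)])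
  have Ks: "?K \<subseteq> chart_img c" using K map_in_img[OF c] by auto
  have F0: "?F i x = 0" if "x \<in> chart_img c" "x \<notin> ?K" for i x
  proof -
    have "chart_inv c x \<notin> K" using that map_inv[OF c] by (metis imageI)
    then show ?thesis by (simp add: K)
  qed
  note F = integral_partial_derivative_open[OF open_img[OF c] C1_on_mult[OF w1 Y1] cK Ks F0]
  have dF: "frechet_derivative (?F i) (at x) (axis i 1)
      = ?w x * partial_deriv (?Y i) i x + partial_deriv ?w i x * ?Y i x" if "x \<in> chart_img c" for i x
    using frechet_derivative_at[OF has_derivative_mult[OF C1_on_frechet[OF w1 that] C1_on_frechet[OF Y1[of i] that]]]
    by (simp add: partial_deriv_def fun_eq_iff)
  have point: "chart_density c (chart_inv c x) * ?h (chart_inv c x)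
      = (\<Sum>i\<in>UNIV. frechet_derivative (?F i) (at x) (axis i 1))" if x: "x \<in> chart_img c" for x
  proof -
    let ?p = "chart_inv c x"
    have p: "?p \<in> chart_dom c" by (rule inv_in_dom[OF c x])
    have "chart_density c ?p * (w ?p * chart_op c z ?p) = (\<Sum>i\<in>UNIV. ?w x * partial_deriv (?Y i) i x)"
      using volume_density_pos[OF c p]
      by (simp add: chart_density_def chart_op_def map_inv[OF c x] exp_minus sum_distrib_left[symmetric] field_simps)
    moreover have "chart_density c ?p * energy z w ?p = (\<Sum>i\<in>UNIV. partial_deriv ?w i x * ?Y i x)"
      by (simp add: energy_chart[OF C1_fun_Suc[OF z] w c p] chart_energy_def inner_vec_def weighted_flux_eq
          chart_differential_def map_inv[OF c x] sum_distrib_left mult_ac)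
    ultimately show ?thesis by (simp add: dF[OF x] sum.distrib distrib_left)
  qed
  have h0: "?h p = 0" if "p \<notin> chart_dom c" for p
  proof -
    have "p \<notin> K" using that K(2) by auto
    then show ?thesis using K(3) e0 by simp
  qed
  have "(\<integral>p. ?h p \<partial>\<mu>) = (\<integral>x. (if x \<in> chart_img c then chart_density c (chart_inv c x) * ?h (chart_inv c x) else 0) \<partial>lborel)"
    by (rule integral_in_chart[OF c _ h0])
      (auto intro!: borel_measurable_continuous_onI continuous_on_add c1 c2)
  also have "\<dots> = (\<integral>x. (\<Sum>i\<in>UNIV. if x \<in> chart_img c then frechet_derivative (?F i) (at x) (axis i 1) else 0) \<partial>lborel)"
    by (intro Bochner_Integration.integral_cong refl) (simp add: point)
  also have "\<dots> = 0" using F by (subst Bochner_Integration.integral_sum) auto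
  finally show "(\<integral>p. w p * chart_op c z p \<partial>\<mu>) = - (\<integral>p. energy z w p \<partial>\<mu>)"
    using continuous_integrable[OF c1] continuous_integrable[OF c2] by simp
qed

text \<open>
  Suppose that the formula in \<open>c\<close> exceeds the one in \<open>d\<close> at a point, hence near it. Integrated
  against a cut-off function supported there, the difference is positive; but Green's formula in
  either chart gives minus the integral of the energy density, which is the same for both.
\<close>

lemma chart_op_le:
  assumes z: "Ck_fun A (Suc (Suc 0)) z" and c: "c \<in> A" "p \<in> chart_dom c" and d: "d \<in> A" "p \<in> chart_dom d"
  shows "chart_op c z p \<le> chart_op d z p"
proof (rule ccontr)
  assume less: "\<not> ?thesis"
  let ?V = "chart_dom c \<inter> chart_dom d"
  let ?h = "\<lambda>q. chart_op c z q - chart_op d z q"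
  have oV: "open ?V" by (intro open_Int open_dom c d)
  have "continuous_on ?V ?h"
    by (intro continuous_intros continuous_on_subset[OF chart_op_continuous[OF z c(1)]]
        continuous_on_subset[OF chart_op_continuous[OF z d(1)]]) auto
  then have "open (?h -` {0<..} \<inter> ?V)"
    using continuous_on_open_vimage[OF oV, of ?h] open_greaterThan by blast
  moreover have "p \<in> ?h -` {0<..} \<inter> ?V" using less c d by auto
  ultimately obtain \<eta> K where \<eta>: "Ck_fun A (Suc 0) \<eta>" "\<And>q. \<eta> q \<ge> 0" "\<eta> p > 0" "compact K"
    "K \<subseteq> chart_dom c \<inter> (?h -` {0<..} \<inter> ?V)" "\<And>q. q \<notin> K \<Longrightarrow> \<eta> q = 0"
    using bump_exists[OF c] by blast
  then have Kc: "K \<subseteq> chart_dom c" and Kd: "K \<subseteq> chart_dom d" by auto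
  note gc = green_in_chart[OF z \<eta>(1) c(1) \<eta>(4) Kc \<eta>(6)] and gd = green_in_chart[OF z \<eta>(1) d(1) \<eta>(4) Kd \<eta>(6)]
  have eq: "\<eta> q * chart_op c z q - \<eta> q * chart_op d z q = \<eta> q * ?h q" for q by (simp add: algebra_simps)
  have "(\<integral>q. \<eta> q * ?h q \<partial>\<mu>) = 0"
    using gc gd continuous_integrable[OF gc(1)] continuous_integrable[OF gd(1)] by (simp add: eq[symmetric])
  moreover have "(\<integral>q. \<eta> q * ?h q \<partial>\<mu>) > 0"
  proof (rule integral_pos)
    show "continuous_on UNIV (\<lambda>q. \<eta> q * ?h q)"
      unfolding eq[symmetric] by (intro continuous_intros gc gd)
    show "0 \<le> \<eta> q * ?h q" for q
      using \<eta>(2)[of q] \<eta>(5) \<eta>(6)[of q] by (cases "q \<in> K") (auto intro!: mult_nonneg_nonneg)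
    show "0 < \<eta> p * ?h p" using less \<eta>(3) by simp
  qed
  ultimately show False by simp
qed

lemma L_op_chart:
  assumes "Ck_fun A (Suc (Suc 0)) z" "c \<in> A" "p \<in> chart_dom c"
  shows "L_op A g T f z p = chart_op c z p"
  unfolding L_op_chart_at
  using chart_op_le[OF assms(1) chart_at assms(2,3)] chart_op_le[OF assms chart_at] by simp

lemma energy_sum:
  assumes z: "Ck_fun A (Suc k) z" and \<psi>: "\<And>i. i \<in> P \<Longrightarrow> Ck_fun A (Suc 0) (\<psi> i)"
    and s: "Ck_fun A (Suc 0) (\<lambda>q. \<Sum>i\<in>P. \<psi> i q)"
  shows "energy z (\<lambda>q. \<Sum>i\<in>P. \<psi> i q) p = (\<Sum>i\<in>P. energy z (\<psi> i) p)"
proof -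
  obtain c where c: "c \<in> A" "p \<in> chart_dom c" by (rule chart_cover)
  have "((\<lambda>x. \<Sum>i\<in>P. \<psi> i (chart_inv c x)) has_derivative (\<lambda>v. \<Sum>i\<in>P. v \<bullet> chart_differential c (\<psi> i) p))
      (at (chart_map c p))"
    by (intro has_derivative_sum chart_has_derivative[OF \<psi> c])
  then have "chart_differential c (\<lambda>q. \<Sum>i\<in>P. \<psi> i q) p = (\<Sum>i\<in>P. chart_differential c (\<psi> i) p)"
    by (intro chart_differential_eqI) (simp add: inner_sum_right)
  then show ?thesis
    using energy_chart[OF C1_fun_Suc[OF z] \<psi> c] energy_chart[OF C1_fun_Suc[OF z] s c]
    by (simp add: chart_energy_def inner_sum_right)
qed

text \<open>
  With a partition of unity subordinate to charts, \<open>w\<close> is a sum of functions to which the formula in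
  a chart applies, and both sides are linear in \<open>w\<close>.
\<close>

theorem green:
  assumes z: "Ck_fun A (Suc (Suc 0)) z" and w: "Ck_fun A (Suc 0) w"
  shows "(\<integral>p. w p * L_op A g T f z p \<partial>\<mu>) = - (\<integral>p. energy z w p \<partial>\<mu>)"
proof -
  obtain P :: "'m set" and c \<eta> K where P: "finite P"
    "\<And>i. i \<in> P \<Longrightarrow> c i \<in> A" "\<And>i. i \<in> P \<Longrightarrow> Ck_fun A (Suc 0) (\<eta> i)" "\<And>i. i \<in> P \<Longrightarrow> compact (K i)"
    "\<And>i. i \<in> P \<Longrightarrow> K i \<subseteq> chart_dom (c i)" "\<And>i q. i \<in> P \<Longrightarrow> q \<notin> K i \<Longrightarrow> \<eta> i q = 0"
    "\<And>q. (\<Sum>i\<in>P. \<eta> i q) > 0"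
    by (rule finite_bumps) blast
  define \<sigma> where "\<sigma> q = (\<Sum>i\<in>P. \<eta> i q)" for q
  have \<sigma>: "\<sigma> q > 0" for q using P(7) by (simp add: \<sigma>_def)
  define \<psi> where "\<psi> i q = \<eta> i q * (w q / \<sigma> q)" for i q
  have \<psi>1: "Ck_fun A (Suc 0) (\<psi> i)" if "i \<in> P" for i
    unfolding C1_fun_iff \<psi>_def \<sigma>_def
    using w P(3) that P(7) unfolding C1_fun_iff
    by (intro ballI C1_on_mult C1_on_divide C1_on_sum) (auto simp: less_imp_neq[symmetric])
  have \<psi>0: "\<psi> i q = 0" if "i \<in> P" "q \<notin> K i" for i q using P(6)[OF that] by (simp add: \<psi>_def)
  have w_eq: "(\<Sum>i\<in>P. \<psi> i q) = w q" for q
    using \<sigma>[of q] unfolding \<psi>_def sum_distrib_right[symmetric] \<sigma>_def[symmetric] by simp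
  have eq: "\<psi> i p * L_op A g T f z p = \<psi> i p * chart_op (c i) z p" if "i \<in> P" for i p
    using L_op_chart[OF z P(2)[OF that], of p] \<psi>0[OF that, of p] P(5)[OF that] by (cases "p \<in> K i") auto
  note gr = green_in_chart[OF z \<psi>1 P(2) P(4) P(5) \<psi>0]
  have "(\<integral>p. w p * L_op A g T f z p \<partial>\<mu>) = (\<integral>p. (\<Sum>i\<in>P. \<psi> i p * chart_op (c i) z p) \<partial>\<mu>)"
    by (intro Bochner_Integration.integral_cong refl) (simp add: w_eq[symmetric] sum_distrib_right eq)
  also have "\<dots> = (\<Sum>i\<in>P. \<integral>p. \<psi> i p * chart_op (c i) z p \<partial>\<mu>)"
    using gr(1) by (intro Bochner_Integration.integral_sum continuous_integrable) auto
  also have "\<dots> = - (\<Sum>i\<in>P. \<integral>p. energy z (\<psi> i) p \<partial>\<mu>)" using gr(2) by (simp add: sum_negf)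
  also have "\<dots> = - (\<integral>p. (\<Sum>i\<in>P. energy z (\<psi> i) p) \<partial>\<mu>)"
    by (subst Bochner_Integration.integral_sum) (auto intro!: continuous_integrable energy_continuous z \<psi>1)
  also have "\<dots> = - (\<integral>p. energy z w p \<partial>\<mu>)"
    using energy_sum[OF z \<psi>1, of P "\<lambda>i. i"] w by (simp add: w_eq)
  finally show ?thesis .
qed

corollary L_op_self_adjoint:
  assumes z: "Ck_fun A (Suc (Suc 0)) z" and w: "Ck_fun A (Suc (Suc 0)) w"
  shows "(\<integral>p. w p * L_op A g T f z p \<partial>\<mu>) = (\<integral>p. z p * L_op A g T f w p \<partial>\<mu>)"
  unfolding green[OF z C1_fun_Suc[OF w]] green[OF w C1_fun_Suc[OF z]] energy_sym[OF z w] ..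

section \<open>Functions of space and time\<close>

lemma smooth_fun_time_slice:
  assumes u: "smooth_fun_time A J u" and t: "t \<in> J"
  shows "Ck_fun A k (\<lambda>p. u p t)"
  unfolding Ck_fun_def
proof (intro ballI Ck_on_local)
  fix c x assume c: "c \<in> A" and x: "x \<in> chart_img c"
  obtain W G where W: "open W" "(x, t) \<in> W" "\<forall>k. Ck_on k W G"
    "\<forall>y\<in>(chart_img c \<times> J) \<inter> W. G y = (\<lambda>(x, t). u (chart_inv c x) t) y"
    using u c x t unfolding smooth_fun_time_def smooth_on_def by (metis SigmaI)
  let ?W = "{x. (x, t) \<in> W}"
  have oW: "open ?W"
    using open_vimage[OF W(1), of "\<lambda>x. (x, t)"] by (simp add: vimage_def continuous_intros)
  have "Ck_on k ?W (\<lambda>x. G (x, t))" using Ck_on_slice[OF W(1)] W(3) by blast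
  then have "Ck_on k (chart_img c \<inter> ?W) (\<lambda>x. G (x, t))" by (rule Ck_on_subset) simp
  then have "Ck_on k (chart_img c \<inter> ?W) (\<lambda>x. u (chart_inv c x) t)"
    by (rule Ck_on_cong[rotated 2]) (use oW open_img[OF c] W(4) t in auto)
  then show "\<exists>W. open W \<and> x \<in> W \<and> Ck_on k W (\<lambda>x. u (chart_inv c x) t)"
    using oW open_img[OF c] x W(2) by (intro exI[of _ "chart_img c \<inter> ?W"]) auto
qed

text \<open>
  Near each point \<open>u\<close> is the restriction of a smooth function \<open>G\<close> of the coordinates and time that is
  defined beyond the end points of the interval, and the time derivative of \<open>u\<close> is the derivative
  of \<open>G\<close> in the direction \<open>(0, 1)\<close>. Continuity is local, so this settles it on the whole product.
\<close>

lemma smooth_fun_time_derivative: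
  assumes ab: "a < b" and u: "smooth_fun_time A {a..b} u"
  defines "ut \<equiv> \<lambda>p t. vector_derivative (u p) (at t within {a..b})"
  shows "t \<in> {a..b} \<Longrightarrow> (u p has_real_derivative ut p t) (at t within {a..b})"
    and "continuous_on (UNIV \<times> {a..b}) (\<lambda>(p, t). ut p t)"
    and "continuous_on (UNIV \<times> {a..b}) (\<lambda>(p, t). u p t)"
proof -
  have main: "\<exists>V. open V \<and> (p0, t0) \<in> V \<and>
      (\<forall>(p, t)\<in>V \<inter> UNIV \<times> {a..b}. (u p has_real_derivative ut p t) (at t within {a..b})) \<and>
      continuous_on ((UNIV \<times> {a..b}) \<inter> V) (\<lambda>(p, t). ut p t) \<and>
      continuous_on ((UNIV \<times> {a..b}) \<inter> V) (\<lambda>(p, t). u p t)" if t0: "t0 \<in> {a..b}" for p0 t0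
  proof -
    obtain c where c: "c \<in> A" "p0 \<in> chart_dom c" by (rule chart_cover)
    obtain W G where W: "open W" "(chart_map c p0, t0) \<in> W" "\<forall>k. Ck_on k W G"
      "\<forall>y\<in>(chart_img c \<times> {a..b}) \<inter> W. G y = (\<lambda>(x, t). u (chart_inv c x) t) y"
      using u c t0 map_in_img[OF c] unfolding smooth_fun_time_def smooth_on_def by (metis SigmaI)
    let ?\<kappa> = "\<lambda>(p, t::real). (chart_map c p, t)"
    let ?V = "(chart_dom c \<times> UNIV) \<inter> ?\<kappa> -` W"
    have \<kappa>: "continuous_on (chart_dom c \<times> UNIV) ?\<kappa>"
      unfolding case_prod_unfold
      by (intro continuous_intros continuous_on_compose2[OF continuous_map[OF c(1)]]) auto
    have oV: "open ?V"
      by (rule continuous_open_preimage[OF \<kappa> _ W(1)]) (intro open_Times open_dom c open_UNIV)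
    have uG: "u p t = G (chart_map c p, t)" if "(p, t) \<in> ?V" "t \<in> {a..b}" for p t
      using W(4) that map_in_img[OF c(1)] inv_map[OF c(1)] by auto
    have "Ck_on (Suc 0) W G" using W(3) by blast
    then have G: "\<And>y. y \<in> W \<Longrightarrow> (G has_derivative frechet_derivative G (at y)) (at y)"
      "continuous_on W (\<lambda>y. frechet_derivative G (at y) (0, 1))"
      by (auto simp: Ck_on.simps frechet_derivative_works)
    have "Ck_on 0 W G" using W(3) by blast
    then have G0: "continuous_on W G" by (simp add: Ck_on.simps)
    have der: "(u p has_vector_derivative frechet_derivative G (at (chart_map c p, t)) (0, 1)) (at t within {a..b})"
      if V: "(p, t) \<in> ?V" and t: "t \<in> {a..b}" for p t
    proof -
      let ?x = "chart_map c p" and ?S = "{s. (chart_map c p, s) \<in> W}"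
      let ?D = "frechet_derivative G (at (?x, t))"
      have xW: "(?x, t) \<in> W" using V by auto
      have "((\<lambda>s. G (?x, s)) has_derivative (\<lambda>r. ?D (0, r))) (at t)"
        by (rule has_derivative_compose[of "\<lambda>s. (?x, s)" "\<lambda>r. (0, r)", OF _ G(1)[OF xW]])
          (auto intro!: derivative_eq_intros)
      moreover have "(\<lambda>r. ?D (0, r)) = (\<lambda>r. r *\<^sub>R ?D (0, 1))"
      proof
        show "?D (0, r) = r *\<^sub>R ?D (0, 1)" for r
          using linear_scale[OF has_derivative_linear[OF G(1)[OF xW]], of r "(0, 1)"]
          by (simp only: scaleR_Pair scaleR_zero_right) simp
      qed
      ultimately have "((\<lambda>s. G (?x, s)) has_derivative (\<lambda>r. r *\<^sub>R ?D (0, 1))) (at t)" by metis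
      then have d: "((\<lambda>s. G (?x, s)) has_vector_derivative ?D (0, 1)) (at t within {a..b})"
        unfolding has_vector_derivative_def by (rule has_derivative_at_withinI)
      have "open ?S" using open_vimage[OF W(1), of "\<lambda>s. (?x, s)"] by (simp add: vimage_def continuous_intros)
      then obtain e where e: "e > 0" "ball t e \<subseteq> ?S" using xW open_contains_ball by blast
      show ?thesis
      proof (rule has_vector_derivative_transform_within[OF d e(1) t])
        fix s assume s: "s \<in> {a..b}" "dist s t < e"
        then have "s \<in> ball t e" by (simp add: dist_commute)
        then have "(?x, s) \<in> W" using e(2) by blast
        then show "G (?x, s) = u p s" using uG[of p s] V s by auto
      qed
    qed
    have ut: "ut p t = frechet_derivative G (at (chart_map c p, t)) (0, 1)" if "(p, t) \<in> ?V" "t \<in> {a..b}" for p t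
      using der[OF that] vector_derivative_within_cbox[of a b t "u p"] ab that(2) by (simp add: ut_def cbox_interval)
    have sub: "(UNIV \<times> {a..b}) \<inter> ?V \<subseteq> chart_dom c \<times> UNIV" by auto
    have "continuous_on ((UNIV \<times> {a..b}) \<inter> ?V) (\<lambda>y. frechet_derivative G (at (?\<kappa> y)) (0, 1))"
      by (rule continuous_on_compose2[OF G(2) continuous_on_subset[OF \<kappa> sub]]) fastforce
    then have "continuous_on ((UNIV \<times> {a..b}) \<inter> ?V) (\<lambda>(p, t). ut p t)"
      by (rule continuous_on_eq) (use ut in auto)
    moreover have "continuous_on ((UNIV \<times> {a..b}) \<inter> ?V) (\<lambda>y. G (?\<kappa> y))"
      by (rule continuous_on_compose2[OF G0 continuous_on_subset[OF \<kappa> sub]]) fastforce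
    then have "continuous_on ((UNIV \<times> {a..b}) \<inter> ?V) (\<lambda>(p, t). u p t)"
      by (rule continuous_on_eq) (use uG in auto)
    moreover have "\<forall>(p, t)\<in>?V \<inter> UNIV \<times> {a..b}. (u p has_real_derivative ut p t) (at t within {a..b})"
      using der ut by (auto simp: has_real_derivative_iff_has_vector_derivative)
    ultimately show ?thesis using oV c W(2) by (intro exI[of _ ?V]) auto
  qed
  show "t \<in> {a..b} \<Longrightarrow> (u p has_real_derivative ut p t) (at t within {a..b})"
    using main[of t p] by blast
  show "continuous_on (UNIV \<times> {a..b}) (\<lambda>(p, t). ut p t)"
    by (rule continuous_on_local) (use main in blast)
  show "continuous_on (UNIV \<times> {a..b}) (\<lambda>(p, t). u p t)"
    by (rule continuous_on_local) (use main in blast)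
qed

lemma continuous_time_bounded:
  assumes "continuous_on (UNIV \<times> {a..b}) (\<lambda>(p::'m, t::real). h p t :: real)"
  obtains B where "B \<ge> 0" "\<And>p t. t \<in> {a..b} \<Longrightarrow> \<bar>h p t\<bar> \<le> B"
proof -
  have "compact ((\<lambda>(p, t). h p t) ` (UNIV \<times> {a..b}))"
    by (rule compact_continuous_image[OF assms]) (intro compact_Times compact_space compact_Icc)
  from compact_imp_bounded[OF this] obtain B where B: "\<And>p t. t \<in> {a..b} \<Longrightarrow> \<bar>h p t\<bar> \<le> B"
    unfolding bounded_iff by fastforce
  then have "\<bar>h p t\<bar> \<le> max B 0" if "t \<in> {a..b}" for p t using that by (meson max.coboundedI1)
  then show thesis using that[of "max B 0"] by simp
qed

lemma continuous_time_slice: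
  assumes "continuous_on (UNIV \<times> {a..b}) (\<lambda>(p::'m, t::real). h p t :: real)" "t \<in> {a..b}"
  shows "continuous_on UNIV (\<lambda>p. h p t)"
proof -
  have "continuous_on UNIV (\<lambda>p::'m. (p, t))" by (intro continuous_intros)
  from continuous_on_compose2[OF assms(1) this] show ?thesis
    using assms(2) by (simp add: image_subset_iff)
qed

section \<open>Log-convexity along the heat flow\<close>

text \<open>
  The case \<open>\<phi> = 0\<close>. The tangent bound applies because \<open>\<integral> v (m + s) v (m - s)\<close> is constant in \<open>s\<close>;
  if \<open>I\<close> vanishes at time \<open>a\<close>, the left-hand side is zero.
\<close>

lemma heat_flow_energy_bound:
  assumes ab: "a < b"
    and v: "\<And>p t. t \<in> {a..b} \<Longrightarrow> (v p has_real_derivative L_op A g T f (\<lambda>q. v q t) p) (at t within {a..b})"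
    and C2: "\<And>t. t \<in> {a..b} \<Longrightarrow> Ck_fun A (Suc (Suc 0)) (\<lambda>p. v p t)"
    and cv: "continuous_on (UNIV \<times> {a..b}) (\<lambda>(p, t). v p t)"
    and cl: "continuous_on (UNIV \<times> {a..b}) (\<lambda>(p, t). L_op A g T f (\<lambda>q. v q t) p)"
  shows "I_fun \<mu> v a * exp (2 * U_fun A g T \<mu> v a * (b - a)) \<le> I_fun \<mu> v b"
proof (cases "I_fun \<mu> v a = 0")
  case True
  then show ?thesis by (simp add: I_fun_def)
next
  case False
  then have pos: "I_fun \<mu> v a > 0" by (simp add: I_fun_def order_less_le)
  let ?L = "\<lambda>p t. L_op A g T f (\<lambda>q. v q t) p"
  note fin = finite_\<mu>
  have meas: "h \<in> borel_measurable \<mu>" if "continuous_on UNIV h" for h :: "'m \<Rightarrow> real"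
    using continuous_integrable[OF that] by (rule borel_measurable_integrable)
  have sv: "continuous_on UNIV (\<lambda>p. v p t)" and sl: "continuous_on UNIV (\<lambda>p. ?L p t)" if "t \<in> {a..b}" for t
    using continuous_time_slice[OF cv that] continuous_time_slice[OF cl that] .
  obtain Bv where Bv: "Bv \<ge> 0" "\<And>p t. t \<in> {a..b} \<Longrightarrow> \<bar>v p t\<bar> \<le> Bv"
    using continuous_time_bounded[OF cv] by metis
  obtain Bl where Bl: "Bl \<ge> 0" "\<And>p t. t \<in> {a..b} \<Longrightarrow> \<bar>?L p t\<bar> \<le> Bl"
    using continuous_time_bounded[OF cl] by metis
  have B: "\<bar>v p s * ?L q t\<bar> \<le> Bv * Bl" if "s \<in> {a..b}" "t \<in> {a..b}" for p q s t
    unfolding abs_mult using Bv Bl that by (intro mult_mono) auto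
  have deriv: "((\<lambda>t. \<integral>p. (v p t)\<^sup>2 \<partial>\<mu>) has_real_derivative (\<integral>p. 2 * (v p a * ?L p a) \<partial>\<mu>)) (at a within {a..b})"
  proof (rule has_derivative_integral_bounded[OF fin, where B = "2 * (Bv * Bl)"])
    show "((\<lambda>t. (v p t)\<^sup>2) has_real_derivative 2 * (v p t * ?L p t)) (at t within {a..b})" if "t \<in> {a..b}" for p t
      using v[OF that, of p] by (auto intro!: derivative_eq_intros)
    show "\<bar>2 * (v p t * ?L p t)\<bar> \<le> 2 * (Bv * Bl)" if "t \<in> {a..b}" for p t
      using B[OF that that, of p p] by simp
    show "integrable \<mu> (\<lambda>p. (v p t)\<^sup>2)" if "t \<in> {a..b}" for t
      by (intro continuous_integrable continuous_intros sv that)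
    show "(\<lambda>p. 2 * (v p a * ?L p a)) \<in> borel_measurable \<mu>"
      by (intro meas continuous_intros sv sl) (use ab in auto)
  qed (use ab in auto)
  have D: "(\<integral>p. 2 * (v p a * ?L p a) \<partial>\<mu>) = 2 * D_fun A g T \<mu> v a"
    using green[OF C2 C1_fun_Suc[OF C2], of a a] ab by (simp add: D_fun_def energy_def)
  have mid: "(I_fun \<mu> v m)\<^sup>2 \<le> I_fun \<mu> v (m - h) * I_fun \<mu> v (m + h)"
    if h: "0 \<le> h" "a \<le> m - h" "m + h \<le> b" for m h
  proof -
    \<comment> \<open>the derivative \<open>k'\<close> of \<open>k\<close> has integral zero since \<open>L\<close> is self-adjoint;
      hence the integral of \<open>k\<close> is the same for \<open>s = 0\<close> and \<open>s = h\<close>\<close>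
    define k where "k p s = v p (m + s) * v p (m - s)" for p s
    define k' where "k' p s = v p (m - s) * ?L p (m + s) - v p (m + s) * ?L p (m - s)" for p s
    have ms: "m + s \<in> {a..b}" "m - s \<in> {a..b}" if "s \<in> {0..h}" for s using that h by auto
    have "((\<lambda>s. \<integral>p. k p s \<partial>\<mu>) has_real_derivative 0) (at s within {0..h})" if s: "s \<in> {0..h}" for s
    proof -
      have "((\<lambda>s. \<integral>p. k p s \<partial>\<mu>) has_real_derivative (\<integral>p. k' p s \<partial>\<mu>)) (at s within {0..h})"
      proof (rule has_derivative_integral_bounded[OF fin s, where B = "2 * (Bv * Bl)"])
        fix p t assume t: "t \<in> {0..h}"
        have "((\<lambda>s. v p (m + 1 * s)) has_real_derivative ?L p (m + t) * 1) (at t within {0..h})"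
          by (rule DERIV_affine_within[where S = "{a..b}"]) (use v[OF ms(1)[OF t]] h in auto)
        moreover have "((\<lambda>s. v p (m + (- 1) * s)) has_real_derivative ?L p (m - t) * (- 1)) (at t within {0..h})"
          by (rule DERIV_affine_within[where S = "{a..b}"]) (use v[OF ms(2)[OF t]] h in auto)
        ultimately show "(k p has_real_derivative k' p t) (at t within {0..h})"
          unfolding k_def k'_def by (auto intro!: derivative_eq_intros simp: algebra_simps)
        show "\<bar>k' p t\<bar> \<le> 2 * (Bv * Bl)"
          using B[OF ms(2)[OF t] ms(1)[OF t], of p p] B[OF ms[OF t], of p p] unfolding k'_def by linarith
      next
        show "integrable \<mu> (\<lambda>p. k p t)" if "t \<in> {0..h}" for t
          unfolding k_def by (intro continuous_integrable continuous_intros sv ms that)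
        show "(\<lambda>p. k' p s) \<in> borel_measurable \<mu>"
          unfolding k'_def by (intro meas continuous_intros sv sl ms s)
      qed
      moreover have "(\<integral>p. k' p s \<partial>\<mu>) = 0"
      proof -
        have "(\<integral>p. k' p s \<partial>\<mu>) = (\<integral>p. v p (m - s) * ?L p (m + s) \<partial>\<mu>) - (\<integral>p. v p (m + s) * ?L p (m - s) \<partial>\<mu>)"
          unfolding k'_def
          by (intro Bochner_Integration.integral_diff continuous_integrable continuous_intros sv sl ms s)
        then show ?thesis using L_op_self_adjoint[OF C2[OF ms(1)[OF s]] C2[OF ms(2)[OF s]]] by simp
      qed
      ultimately show ?thesis by simp
    qed
    then obtain C where "\<And>s. s \<in> {0..h} \<Longrightarrow> (\<integral>p. k p s \<partial>\<mu>) = C"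
      using has_field_derivative_zero_constant[of "{0..h}" "\<lambda>s. \<integral>p. k p s \<partial>\<mu>"] by auto
    then have "(\<integral>p. k p 0 \<partial>\<mu>) = (\<integral>p. k p h \<partial>\<mu>)" using h by simp
    then have "I_fun \<mu> v m = (\<integral>p. v p (m - h) * v p (m + h) \<partial>\<mu>)"
      by (simp add: k_def I_fun_def power2_eq_square mult.commute)
    then show ?thesis
      unfolding I_fun_def using h
      by (simp only:) (intro integral_Cauchy_Schwarz continuous_integrable continuous_intros sv; simp)
  qed
  have "I_fun \<mu> v a * exp (2 * D_fun A g T \<mu> v a / I_fun \<mu> v a * (b - a)) \<le> I_fun \<mu> v b"
  proof (rule midpoint_log_convex_tangent[OF ab pos _ _ mid])
    show "(I_fun \<mu> v has_real_derivative 2 * D_fun A g T \<mu> v a) (at a within {a..b})"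
      using deriv unfolding D by (simp only: I_fun_def[abs_def])
  qed (simp add: I_fun_def)
  then show ?thesis by (simp add: U_fun_def)
qed

text \<open>
  Linearity of the derivatives requires differentiability, which for the flux of the multiple \<open>r z\<close>
  follows because it is \<open>r\<close> times the flux of \<open>z\<close> on the whole open coordinate domain.
\<close>

lemma L_op_scale:
  assumes z: "Ck_fun A (Suc (Suc 0)) z"
  shows "L_op A g T f (\<lambda>q. r * z q) p = r * L_op A g T f z p"
proof -
  let ?c = "chart_at A p"
  note c = chart_at[of p]
  have d: "chart_differential ?c (\<lambda>q. r * z q) q = r *\<^sub>R chart_differential ?c z q" if "q \<in> chart_dom ?c" for q
    using has_derivative_mult_right[OF chart_has_derivative[OF z c(1) that], of r]
    by (intro chart_differential_eqI) simp
  have flux: "weighted_flux ?c (\<lambda>q. r * z q) i x = r * weighted_flux ?c z i x" if "x \<in> chart_img ?c" for i x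
    using d[OF inv_in_dom[OF c(1) that]]
    by (simp add: weighted_flux_eq gradient_eq matrix_vector_mult_scaleR)
  have "partial_deriv (weighted_flux ?c (\<lambda>q. r * z q) i) i (chart_map ?c p)
      = r * partial_deriv (weighted_flux ?c z i) i (chart_map ?c p)" for i
  proof -
    let ?x = "chart_map ?c p"
    have x: "?x \<in> chart_img ?c" by (rule map_in_img[OF c])
    have "((\<lambda>x. r * weighted_flux ?c z i x) has_derivative
        (\<lambda>v. r * frechet_derivative (weighted_flux ?c z i) (at ?x) v)) (at ?x)"
      by (intro has_derivative_mult_right C1_on_frechet[OF weighted_flux_C1[OF z c(1)] x])
    then have "(weighted_flux ?c (\<lambda>q. r * z q) i has_derivative
        (\<lambda>v. r * frechet_derivative (weighted_flux ?c z i) (at ?x) v)) (at ?x)"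
      by (rule has_derivative_transform_within_open[OF _ open_img[OF c(1)] x]) (simp add: flux)
    from frechet_derivative_at[OF this, symmetric] show ?thesis by (simp add: partial_deriv_def)
  qed
  then show ?thesis by (simp add: L_op_chart_at chart_op_def sum_distrib_left[symmetric])
qed

lemma Ck_fun_scale:
  assumes "Ck_fun A k z" shows "Ck_fun A k (\<lambda>q. r * z q)"
  unfolding Ck_fun_def
proof
  fix c assume c: "c \<in> A"
  then have "Ck_on k (chart_img c) (\<lambda>x. z (chart_inv c x))" using assms unfolding Ck_fun_def by blast
  then show "Ck_on k (chart_img c) (\<lambda>x. r * z (chart_inv c x))"
    by (rule Ck_on_bounded_linear[OF open_img[OF c] bounded_linear_mult_right])
qed

end

theorem corollary2p2:
  fixes A :: "('m::t2_space, 'n::finite) chart set"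
    and g T :: "('m, 'n) tensor_components"
    and \<nu> \<mu> :: "'m measure"
    and f :: "'m \<Rightarrow> real"
    and u :: "'m \<Rightarrow> real \<Rightarrow> real"
    and \<phi> :: "real \<Rightarrow> real"
    and a b :: real
  assumes "compact (UNIV :: 'm set)"
    and "smooth_atlas A"
    and "riemannian_metric A g"
    and "riemannian_volume A g \<nu>"
    and "smooth_fun A f"
    and "\<mu> = weighted_measure \<nu> f"
    and "smooth_tensor11 A T"
    and "symmetric_tensor11 A g T"
    and "pos_def_tensor11 A g T"
    and "a < b"
    and "smooth_on {a..b} \<phi>"
    and "smooth_fun_time A {a..b} u"
    and "\<exists>x. u x a \<noteq> 0"
    and "\<And>x t. t \<in> {a..b} \<Longrightarrow>
      vector_derivative (\<lambda>s. u x s) (at t within {a..b}) - L_op A g T f (\<lambda>y. u y t) x = \<phi> t * u x t"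
  shows "I_fun \<mu> u b \<ge>
    I_fun \<mu> u a * exp (2 * integral {a..b} \<phi> + 2 * U_fun A g T \<mu> u a * (b - a))"
proof -
  interpret M: closed_weighted_manifold A g T \<nu> f
    by (rule closed_weighted_manifold.intro[OF assms(1-5,7,8)])
  have \<mu>: "\<mu> = M.\<mu>" by (simp add: M.\<mu>_def assms(6))
  \<comment> \<open>the integrating factor, normalised to \<open>1\<close> at time \<open>a\<close> so that \<open>U\<close> does not change there\<close>
  define E where "E t = exp (- integral {a..t} \<phi>)" for t
  define v where "v p t = E t * u p t" for p t
  let ?ut = "\<lambda>p t. vector_derivative (u p) (at t within {a..b})"
  have \<phi>: "continuous_on {a..b} \<phi>" by (rule smooth_on_imp_continuous_on[OF assms(11)])
  note u = M.smooth_fun_time_derivative[OF assms(10,12)]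
  have C2: "Ck_fun A (Suc (Suc 0)) (\<lambda>p. u p t)" if "t \<in> {a..b}" for t
    by (rule M.smooth_fun_time_slice[OF assms(12) that])
  have E: "(E has_real_derivative - \<phi> t * E t) (at t within {a..b})" if "t \<in> {a..b}" for t
    unfolding E_def using integral_has_real_derivative[OF \<phi> that] by (auto intro!: derivative_eq_intros)
  then have "continuous_on {a..b} E"
    using DERIV_continuous continuous_on_eq_continuous_within by blast
  then have cE: "continuous_on (UNIV \<times> {a..b}) (\<lambda>(p::'m, t). E t)"
    and c\<phi>: "continuous_on (UNIV \<times> {a..b}) (\<lambda>(p::'m, t). \<phi> t)"
    using \<phi> unfolding case_prod_unfold by (auto intro!: continuous_on_compose2[of "{a..b}" _ _ snd] continuous_intros)
  have L: "L_op A g T f (\<lambda>q. v q t) p = E t * (?ut p t - \<phi> t * u p t)" if "t \<in> {a..b}" for p t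
    using assms(14)[OF that, of p] unfolding v_def M.L_op_scale[OF C2[OF that]] by (simp add: algebra_simps)
  have "I_fun M.\<mu> v a * exp (2 * U_fun A g T M.\<mu> v a * (b - a)) \<le> I_fun M.\<mu> v b"
  proof (rule M.heat_flow_energy_bound[OF assms(10)])
    show "(v p has_real_derivative L_op A g T f (\<lambda>q. v q t) p) (at t within {a..b})" if "t \<in> {a..b}" for p t
      unfolding L[OF that] unfolding v_def
      using DERIV_mult[OF E[OF that] u(1)[OF that, of p]] by (simp add: algebra_simps)
    show "Ck_fun A (Suc (Suc 0)) (\<lambda>p. v p t)" if "t \<in> {a..b}" for t
      unfolding v_def by (rule M.Ck_fun_scale[OF C2[OF that]])
    show "continuous_on (UNIV \<times> {a..b}) (\<lambda>(p, t). v p t)"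
      using continuous_on_mult[OF cE u(3)] by (simp add: v_def case_prod_unfold)
    have "continuous_on (UNIV \<times> {a..b}) (\<lambda>(p, t). E t * (?ut p t - \<phi> t * u p t))"
      using continuous_on_mult[OF cE continuous_on_diff[OF u(2) continuous_on_mult[OF c\<phi> u(3)]]]
      by (simp add: case_prod_unfold)
    then show "continuous_on (UNIV \<times> {a..b}) (\<lambda>(p, t). L_op A g T f (\<lambda>q. v q t) p)"
      by (rule continuous_on_eq) (auto simp: L)
  qed
  moreover have "I_fun \<mu> v t = (E t)\<^sup>2 * I_fun \<mu> u t" for t
    by (simp add: I_fun_def v_def power_mult_distrib)
  moreover have "E a = 1" by (simp add: E_def)
  moreover from this have "U_fun A g T \<mu> v a = U_fun A g T \<mu> u a"
    by (simp add: U_fun_def D_fun_def I_fun_def v_def)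
  ultimately have "I_fun \<mu> u a * exp (2 * U_fun A g T \<mu> u a * (b - a)) \<le> (E b)\<^sup>2 * I_fun \<mu> u b"
    by (simp add: \<mu>)
  then have "exp (2 * integral {a..b} \<phi>) * (I_fun \<mu> u a * exp (2 * U_fun A g T \<mu> u a * (b - a)))
      \<le> exp (2 * integral {a..b} \<phi>) * ((E b)\<^sup>2 * I_fun \<mu> u b)"
    by (intro mult_left_mono) auto
  also have "\<dots> = I_fun \<mu> u b"
    by (simp add: E_def exp_minus exp_double field_simps)
  finally show ?thesis by (simp add: exp_add mult_ac)
qed

end
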